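(* Let $-\infty\le a<b\le\infty$, let $\mu\in\mathcal{P}(a,b)$ with density $\rho$, and let $g\in\mathscr{C}^{1,2}_{*}(a,b)$ be centered with respect to $\mu$, i.e. $\int_a^b g\,d\mu=0$. If $a$ is finite, assume that either $g'(a)\neq 0$, or $g'(a)=0$ and $g''(a)\neq 0$. If $b$ is finite, assume that either $g'(b)\neq 0$, or $g'(b)=0$ and $g''(b)\neq 0$. Then: (1) The function $$w_g(x)=-\frac{1}{g'(x)\rho(x)}\int_a^x g(y)\rho(y)\,dy,\qquad x\in(a,b),$$ (extended by its limits at the finite endpoints) belongs to $\mathcal{W}(a,b)$. If $a$ is finite, then $w_g(a)=0$ when $g'(a)\neq 0$, and $w_g(a)=-g(a)/g''(a)>0$ when $g'(a)=0$ and $g''(a)\neq 0$. Likewise, if $b$ is finite, then $w_g(b)=0$ when $g'(b)\neq0$, and $w_g(b)=-g(b)/g''(b)>0$ when $g'(b)=0$ and $g''(b)\neq 0$. (2) If in addition $g\in L^2(\mu)$ (which is automatically satisfied if $a$ and $b$ are finite), then $\mu$ satisfies the weighted Poincaré inequality with weight $w_g$ and Poincaré constant $C_P(\mu,w_g)=1$. Furthermore, this inequality is saturated by $g$.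
   Context: Convention: if $a=-\infty$ and/or $b=+\infty$, $[a,b]$ stands for the interval with the infinite endpoint(s) excluded. $\mathscr{C}^{0,1}_+(a,b)$: the set of functions that are continuous and piecewise $\mathscr{C}^1$ (piecewise continuously differentiable) on $[a,b]$ and positive on $(a,b)$. $\mathscr{C}^{1,2}_*(a,b)$: the set of functions $f$ such that $f'\in\mathscr{C}^{0,1}_+(a,b)$ or $-f'\in\mathscr{C}^{0,1}_+(a,b)$. Derivatives at finite endpoints are one-sided. $\mathcal{P}(a,b)$: the set of probability measures $\mu$ on $[a,b]$ having a Lebesgue density $\rho\in\mathscr{C}^{0,1}_+(a,b)$ with $\rho(a)>0$ if $a$ is finite and $\rho(b)>0$ if $b$ is finite. $\mathcal{W}(a,b)$ (weights): the set of continuous functions on $[a,b]$ that are piecewise $\mathscr{C}^1$ and positive on $(a,b)$ (no differentiability is required at the endpoints). For $\mu\in\mathcal{P}(a,b)$ and $w\in\mathcal{W}(a,b)$, $H^1(\mu,w)=\{f\in L^2(\mu): w^{1/2}f'\in L^2(\mu)\}$, with $f'$ the weak derivative. $\mu$ satisfies a weighted Poincaré inequality with weight $w$ and constant $C>0$ if $$\int_a^b f^2\,d\mu\le C\int_a^b w\,(f')^2\,d\mu$$ for every $f\in H^1(\mu,w)$ with $\int_a^b f\,d\mu=0$. The Poincaré constant $C_P(\mu,w)$ is the smallest such $C$. A non-null centered function $f\in H^1(\mu,w)$ saturates the inequality if it realizes equality with $C=C_P(\mu,w)$. *)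

theory Defs
  imports "HOL-Probability.Probability"
begin

text \<open>The interval \<open>[a,b]\<close> with infinite endpoints excluded; the open interval \<open>(a,b)\<close> is
  \<^const>\<open>einterval\<close> from the library.\<close>

definition cinterval :: "ereal \<Rightarrow> ereal \<Rightarrow> real set" where
  "cinterval a b = {x. a \<le> ereal x \<and> ereal x \<le> b}"

text \<open>The library notion \<^const>\<open>C1_differentiable_on\<close> uses two-sided derivatives, so it ignores
  one-sided derivatives at the ends of a piece; \<^const>\<open>piecewise_C1_differentiable_on\<close> therefore
  says nothing about \<open>f'\<close> at the break points and at the endpoints. The versions below
  require a one-sided derivative, continuous up to the ends of each piece belonging to \<open>S\<close>.\<close>

definition C1_on :: "real set \<Rightarrow> (real \<Rightarrow> real) \<Rightarrow> bool" where
  "C1_on J f \<longleftrightarrow>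
     (\<exists>f'. (\<forall>x\<in>J. (f has_real_derivative f' x) (at x within J)) \<and> continuous_on J f')"

text \<open>\<open>T\<close> is the finite set of break points: \<open>f\<close> is of class C1 on each subinterval of \<open>S\<close> with no
  break point in its interior.\<close>

definition piecewise_C1_on :: "real set \<Rightarrow> (real \<Rightarrow> real) \<Rightarrow> bool" where
  "piecewise_C1_on S f \<longleftrightarrow>
     (\<exists>T. finite T \<and>
        (\<forall>J. is_interval J \<and> J \<subseteq> S \<and> interior J \<inter> T = {} \<longrightarrow> C1_on J f))"

definition C01_pos :: "ereal \<Rightarrow> ereal \<Rightarrow> (real \<Rightarrow> real) set" where
  "C01_pos a b = {f. continuous_on (cinterval a b) f \<and> piecewise_C1_on (cinterval a b) f \<and>
                     (\<forall>x\<in>einterval a b. f x > 0)}"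

text \<open>The derivative on \<open>[a,b]\<close>, one-sided at finite endpoints.\<close>

definition deriv_on :: "ereal \<Rightarrow> ereal \<Rightarrow> (real \<Rightarrow> real) \<Rightarrow> real \<Rightarrow> real" where
  "deriv_on a b f x = vector_derivative f (at x within cinterval a b)"

definition C12_star :: "ereal \<Rightarrow> ereal \<Rightarrow> (real \<Rightarrow> real) set" where
  "C12_star a b = {f. f differentiable_on cinterval a b \<and>
     (deriv_on a b f \<in> C01_pos a b \<or> (\<lambda>x. - deriv_on a b f x) \<in> C01_pos a b)}"

text \<open>\<open>\<mu> \<in> \<P>(a,b)\<close> with density \<open>\<rho>\<close>. The underlying space of \<open>\<mu>\<close> is \<open>[a,b]\<close>, so that the values of
  functions outside \<open>[a,b]\<close> play no role (not even for measurability).\<close>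

definition prob_with_density :: "ereal \<Rightarrow> ereal \<Rightarrow> real measure \<Rightarrow> (real \<Rightarrow> real) \<Rightarrow> bool" where
  "prob_with_density a b \<mu> \<rho> \<longleftrightarrow>
     \<rho> \<in> C01_pos a b \<and>
     (\<forall>\<alpha>. a = ereal \<alpha> \<longrightarrow> \<rho> \<alpha> > 0) \<and>
     (\<forall>\<beta>. b = ereal \<beta> \<longrightarrow> \<rho> \<beta> > 0) \<and>
     \<mu> = density (restrict_space lborel (cinterval a b)) (\<lambda>x. ennreal (\<rho> x)) \<and>
     prob_space \<mu>"

definition weights :: "ereal \<Rightarrow> ereal \<Rightarrow> (real \<Rightarrow> real) set" where
  "weights a b = {w. continuous_on (cinterval a b) w \<and> piecewise_C1_on (einterval a b) w \<and>
                     (\<forall>x\<in>einterval a b. w x > 0)}"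

definition L2 :: "real measure \<Rightarrow> (real \<Rightarrow> real) set" where
  "L2 \<mu> = {f. f \<in> borel_measurable \<mu> \<and> integrable \<mu> (\<lambda>x. (f x)\<^sup>2)}"

text \<open>Integrability is stated explicitly, since the Bochner integral of a non-integrable function
  is 0 by convention.\<close>

definition centered :: "real measure \<Rightarrow> (real \<Rightarrow> real) \<Rightarrow> bool" where
  "centered \<mu> f \<longleftrightarrow> integrable \<mu> f \<and> (\<integral>x. f x \<partial>\<mu>) = 0"

definition locally_integrable :: "ereal \<Rightarrow> ereal \<Rightarrow> (real \<Rightarrow> real) \<Rightarrow> bool" where
  "locally_integrable a b f \<longleftrightarrow>
     (\<forall>K. compact K \<and> K \<subseteq> einterval a b \<longrightarrow> set_integrable lborel K f)"

definition test_functions :: "ereal \<Rightarrow> ereal \<Rightarrow> (real \<Rightarrow> real) set" where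
  "test_functions a b = {\<phi>. (\<forall>n. (deriv ^^ n) \<phi> differentiable_on UNIV) \<and>
     (\<exists>K. compact K \<and> K \<subseteq> einterval a b \<and> (\<forall>x. x \<notin> K \<longrightarrow> \<phi> x = 0))}"

definition has_weak_deriv ::
    "ereal \<Rightarrow> ereal \<Rightarrow> (real \<Rightarrow> real) \<Rightarrow> (real \<Rightarrow> real) \<Rightarrow> bool" where
  "has_weak_deriv a b f h \<longleftrightarrow>
     locally_integrable a b f \<and> locally_integrable a b h \<and>
     (\<forall>\<phi>\<in>test_functions a b.
        (LBINT x:einterval a b. f x * deriv \<phi> x) = - (LBINT x:einterval a b. h x * \<phi> x))"

text \<open>A representative of the weak derivative, which is unique up to null sets; it is meaningful
  only if \<^prop>\<open>\<exists>h. has_weak_deriv a b f h\<close>.\<close>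

definition weak_deriv :: "ereal \<Rightarrow> ereal \<Rightarrow> (real \<Rightarrow> real) \<Rightarrow> real \<Rightarrow> real" where
  "weak_deriv a b f = (SOME h. has_weak_deriv a b f h)"

definition H1 :: "ereal \<Rightarrow> ereal \<Rightarrow> real measure \<Rightarrow> (real \<Rightarrow> real) \<Rightarrow> (real \<Rightarrow> real) set" where
  "H1 a b \<mu> w = {f. f \<in> L2 \<mu> \<and> (\<exists>h. has_weak_deriv a b f h) \<and>
                    (\<lambda>x. sqrt (w x) * weak_deriv a b f x) \<in> L2 \<mu>}"

definition weighted_poincare ::
    "ereal \<Rightarrow> ereal \<Rightarrow> real measure \<Rightarrow> (real \<Rightarrow> real) \<Rightarrow> real \<Rightarrow> bool" where
  "weighted_poincare a b \<mu> w C \<longleftrightarrow>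
     C > 0 \<and>
     (\<forall>f\<in>H1 a b \<mu> w. centered \<mu> f \<longrightarrow>
        (\<integral>x. (f x)\<^sup>2 \<partial>\<mu>) \<le> C * (\<integral>x. w x * (weak_deriv a b f x)\<^sup>2 \<partial>\<mu>))"

text \<open>Unspecified if no constant \<open>C\<close> is admissible.\<close>

definition poincare_constant ::
    "ereal \<Rightarrow> ereal \<Rightarrow> real measure \<Rightarrow> (real \<Rightarrow> real) \<Rightarrow> real" where
  "poincare_constant a b \<mu> w = (LEAST C. weighted_poincare a b \<mu> w C)"

definition saturates ::
    "ereal \<Rightarrow> ereal \<Rightarrow> real measure \<Rightarrow> (real \<Rightarrow> real) \<Rightarrow> (real \<Rightarrow> real) \<Rightarrow> bool" where
  "saturates a b \<mu> w f \<longleftrightarrow>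
     f \<in> H1 a b \<mu> w \<and> centered \<mu> f \<and> \<not> (AE x in \<mu>. f x = 0) \<and>
     (\<integral>x. (f x)\<^sup>2 \<partial>\<mu>) =
       poincare_constant a b \<mu> w * (\<integral>x. w x * (weak_deriv a b f x)\<^sup>2 \<partial>\<mu>)"

definition wg_inner ::
    "ereal \<Rightarrow> ereal \<Rightarrow> (real \<Rightarrow> real) \<Rightarrow> (real \<Rightarrow> real) \<Rightarrow> real \<Rightarrow> real" where
  "wg_inner a b \<rho> g x = - (1 / (deriv_on a b g x * \<rho> x)) * (LBINT y=a..ereal x. g y * \<rho> y)"

text \<open>The function \<open>w\<^sub>g\<close>, extended from \<open>(a,b)\<close> by its limits at the finite endpoints. The existence
  of the limits is part of the assertion that \<open>w\<^sub>g\<close> is continuous on \<open>[a,b]\<close>.\<close>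

definition wg ::
    "ereal \<Rightarrow> ereal \<Rightarrow> (real \<Rightarrow> real) \<Rightarrow> (real \<Rightarrow> real) \<Rightarrow> real \<Rightarrow> real" where
  "wg a b \<rho> g x =
     (if x \<in> einterval a b then wg_inner a b \<rho> g x
      else Lim (at x within einterval a b) (wg_inner a b \<rho> g))"

end

theory Submission
  imports Defs
begin

text \<open>Assume \<open>g' > 0\<close> (otherwise replace \<open>g\<close> by \<open>- g\<close>, which does not change \<open>w\<^sub>g\<close>) and put
  \<open>G x = \<integral>\<^sub>a\<^sup>x g d\<mu>\<close>, so that \<open>w\<^sub>g g' \<rho> = - G\<close>. By Cauchy--Schwarz,
  \<open>(f x - f y)\<^sup>2 \<le> (g x - g y) \<integral>\<^sub>y\<^sup>x f'\<^sup>2 / g'\<close> for \<open>y < x\<close>, with equality for \<open>f = g\<close>. Integrating over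
  \<open>y < x\<close> against \<open>\<mu> \<otimes> \<mu>\<close>, the left-hand side gives the variance of \<open>f\<close>; on the right-hand side
  exchange the integrals and use that the integral of \<open>g x - g y\<close> over \<open>y < z < x\<close> is \<open>- G z\<close>,
  because \<open>g\<close> is centered. What remains is \<open>\<integral> (- G) f'\<^sup>2 / g' = \<integral> w\<^sub>g f'\<^sup>2 d\<mu>\<close>.

  A function with a weak derivative \<open>h\<close> satisfies \<open>f x - f y = \<integral>\<^sub>y\<^sup>x h\<close> almost everywhere: test against
  smooth approximations of trapezoids with slopes of length \<open>d\<close>, divide by \<open>d\<close>, and let \<open>d\<close> tend
  to 0, using Lebesgue differentiation.\<close>

section \<open>Smooth bump functions\<close>

text \<open>The weight is the one for which \<open>g\<close> solves the Sturm--Liouville equation -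
  (w \<rho> g')' = g \<rho>, so \<open>g\<close> is an eigenfunction with eigenvalue 1. The flux w
  \<rho> g' vanishes at both ends because \<open>g\<close> is centered, so no boundary condition has
  to be imposed. A spectral argument, or integration by parts against f, would need control of f
  near the ends, which may be infinite and where membership in \<open>H1\<close> gives none. The
  double integral avoids this: its integrands are nonnegative, so Tonelli applies in
  \<open>ennreal\<close> before any finiteness is known. The same computation with f = g also shows
  that \<open>g\<close> has finite energy, and testing with \<open>g\<close> shows that no constant
  below 1 is admissible.

  The remaining obstacle is a finite endpoint with g' = 0, where numerator and denominator of the
  weight both vanish. The limit is a ratio of difference quotients, and it is strictly positive
  because a strictly monotone centered function cannot vanish at an endpoint.\<close>

definition expinv :: "real poly \<Rightarrow> real \<Rightarrow> real" where
  "expinv p u = (if u > 0 then poly p (1 / u) * exp (- (1 / u)) else 0)"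

lemma poly_times_exp_minus_tendsto_0:
  fixes p :: "real poly"
  shows "((\<lambda>x. poly p x * exp (- x)) \<longlongrightarrow> 0) at_top"
proof -
  have "((\<lambda>x. \<Sum>i\<le>degree p. coeff p i * (x ^ i / exp x)) \<longlongrightarrow> (\<Sum>i\<le>degree p. coeff p i * 0)) at_top"
    by (intro tendsto_sum tendsto_mult_left tendsto_power_div_exp_0)
  then show ?thesis
    by (simp add: poly_altdef sum_distrib_right exp_minus divide_inverse mult.assoc)
qed

text \<open>The polynomial is a parameter because, with s = 1/u, the operator d/du is - s^2 d/ds and
  sends p(s) exp(-s) to s^2 (p - p')(s) exp(-s): one family contains all derivatives. At 0 the
  exponential beats every polynomial in s.\<close>

lemma expinv_has_derivative:
  "(expinv p has_real_derivative expinv ([:0, 0, 1:] * (p - pderiv p)) u) (at u)"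
proof -
  consider "u > 0" | "u < 0" | "u = 0" by linarith
  then show ?thesis
  proof cases
    case 1
    have "((\<lambda>u. poly p (1 / u) * exp (- (1 / u))) has_real_derivative
        expinv ([:0, 0, 1:] * (p - pderiv p)) u) (at u)"
      using 1 by (auto intro!: derivative_eq_intros DERIV_chain'[OF _ poly_DERIV]
          simp: expinv_def field_simps power2_eq_square)
    then show ?thesis
      by (rule has_field_derivative_transform_within_open[of _ _ _ "{0<..}"])
        (use 1 in \<open>auto simp: expinv_def\<close>)
  next
    case 2
    have "((\<lambda>u. 0) has_real_derivative expinv ([:0, 0, 1:] * (p - pderiv p)) u) (at u)"
      using 2 by (auto simp: expinv_def)
    then show ?thesis
      by (rule has_field_derivative_transform_within_open[of _ _ _ "{..<0}"])
        (use 2 in \<open>auto simp: expinv_def\<close>)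
  next
    case 3
    have left: "((\<lambda>y. expinv p y / y) \<longlongrightarrow> 0) (at_left 0)"
      by (rule tendsto_eventually) (auto simp: eventually_at_filter expinv_def)
    \<comment> \<open>With s = 1/y the difference quotient is s p(s) exp(-s), hence
      \<open>pCons 0 p\<close>.\<close>
    have "((\<lambda>x. expinv p (inverse x) / inverse x) \<longlongrightarrow> 0) at_top"
      by (rule Lim_transform_eventually[OF poly_times_exp_minus_tendsto_0[of "pCons 0 p"]])
        (use eventually_gt_at_top[of 0] in eventually_elim, auto simp: expinv_def field_simps)
    then have right: "((\<lambda>y. expinv p y / y) \<longlongrightarrow> 0) (at_right 0)"
      by (simp add: filterlim_at_right_to_top)
    have "((\<lambda>y. expinv p y / y) \<longlongrightarrow> 0) (at 0)"
      using left right by (rule filterlim_split_at)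
    then show ?thesis
      using 3 by (simp add: has_field_derivative_iff expinv_def)
  qed
qed

text \<open>A set of functions containing the bumps and closed under differentiation, whence smoothness.\<close>

inductive_set bump_space :: "(real \<Rightarrow> real) set" where
  base: "(\<lambda>t. poly r t * expinv p (poly q t)) \<in> bump_space"
| add: "f \<in> bump_space \<Longrightarrow> g \<in> bump_space \<Longrightarrow> (\<lambda>t. f t + g t) \<in> bump_space"

text \<open>The product rule explains the two clauses of \<open>bump_space\<close>: the chain rule
  produces a polynomial prefactor, and the two resulting terms have to be added.\<close>

lemma bump_space_derivative:
  assumes "f \<in> bump_space"
  shows "\<exists>f'\<in>bump_space. \<forall>t. (f has_real_derivative f' t) (at t)"
  using assms
proof induction
  case (base r p q)
  let ?f' = "\<lambda>t. poly (pderiv r) t * expinv p (poly q t) +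
    poly (r * pderiv q) t * expinv ([:0, 0, 1:] * (p - pderiv p)) (poly q t)"
  have "((\<lambda>t. poly r t * expinv p (poly q t)) has_real_derivative ?f' t) (at t)" for t
  proof -
    have "((\<lambda>t. expinv p (poly q t)) has_real_derivative
        expinv ([:0, 0, 1:] * (p - pderiv p)) (poly q t) * poly (pderiv q) t) (at t)"
      by (rule DERIV_chain2[OF expinv_has_derivative poly_DERIV])
    from DERIV_mult[OF poly_DERIV this, of r] show ?thesis
      by (simp add: algebra_simps)
  qed
  moreover have "?f' \<in> bump_space"
    by (intro bump_space.intros)
  ultimately show ?case by (intro bexI[of _ ?f']) auto
next
  case (add f g)
  then obtain f' g' where "f' \<in> bump_space" "g' \<in> bump_space"
    "\<forall>t. (f has_real_derivative f' t) (at t)" "\<forall>t. (g has_real_derivative g' t) (at t)"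
    by blast
  then show ?case
    by (intro bexI[of _ "\<lambda>t. f' t + g' t"]) (auto intro!: DERIV_add bump_space.add)
qed

lemma higher_deriv_bump_space:
  assumes "f \<in> bump_space"
  shows "(deriv ^^ n) f \<in> bump_space"
proof (induction n)
  case (Suc n)
  then obtain f' where "f' \<in> bump_space" "\<forall>t. ((deriv ^^ n) f has_real_derivative f' t) (at t)"
    using bump_space_derivative by blast
  moreover from this have "deriv ((deriv ^^ n) f) = f'"
    by (auto intro!: DERIV_imp_deriv)
  ultimately show ?case by simp
qed (use assms in simp)

text \<open>The test functions will be integrals of bumps. Membership in \<open>bump_space\<close>
  is available for their first derivative, and all further derivatives follow from it.\<close>

lemma antiderivative_bump_space_smooth:
  assumes F: "\<And>t. (F has_real_derivative f t) (at t)" and f: "f \<in> bump_space"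
  shows "(deriv ^^ n) F differentiable_on UNIV"
proof (cases n)
  case 0
  then show ?thesis
    using F by (auto simp: differentiable_on_def intro!: differentiableI has_field_derivative_imp_has_derivative)
next
  case (Suc m)
  have "deriv F = f"
    using F by (auto intro!: DERIV_imp_deriv)
  then have "(deriv ^^ n) F = (deriv ^^ m) f"
    unfolding Suc funpow_Suc_right by simp
  then show ?thesis
    using bump_space_derivative[OF higher_deriv_bump_space[OF f, of m]]
    by (auto simp: differentiable_on_def intro!: differentiableI has_field_derivative_imp_has_derivative)
qed

text \<open>On the open interval and for n > 0 this is exp(-1/(n q)) with q = (t - x) (x + d - t).
  The factor \<open>n\<close> lets it grow to 1 pointwise without enlarging the support, so the
  limit is an indicator.\<close>

definition bump :: "real \<Rightarrow> real \<Rightarrow> nat \<Rightarrow> real \<Rightarrow> real" where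
  "bump x d n t = expinv 1 (real n * ((t - x) * (x + d - t)))"

lemma bump_eq_0: "d > 0 \<Longrightarrow> t \<le> x \<or> x + d \<le> t \<Longrightarrow> bump x d n t = 0"
  unfolding bump_def expinv_def
  by (auto simp: zero_less_mult_iff)

lemma bump_bounds: "0 \<le> bump x d n t" "bump x d n t \<le> 1"
  by (auto simp: bump_def expinv_def)

lemma bump_in_bump_space: "(\<lambda>t. c * bump x d n t) \<in> bump_space"
proof -
  have "(\<lambda>t. c * bump x d n t) =
      (\<lambda>t. poly [:c:] t * expinv 1 (poly (smult (real n) ([:- x, 1:] * [:x + d, -1:])) t))"
    by (auto simp: bump_def algebra_simps)
  then show ?thesis
    by (simp only: bump_space.base)
qed

lemma continuous_bump: "continuous_on S (bump x d n)"
proof -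
  have "bump x d n \<in> bump_space"
    using bump_in_bump_space[of 1] by simp
  then obtain f' where "\<forall>t. (bump x d n has_real_derivative f' t) (at t)"
    using bump_space_derivative by blast
  then show ?thesis
    by (meson DERIV_isCont continuous_at_imp_continuous_on)
qed

lemma borel_measurable_bump [measurable]: "bump x d n \<in> borel_measurable borel"
  by (rule borel_measurable_continuous_onI[OF continuous_bump])

lemma bump_tendsto:
  assumes "d > 0"
  shows "(\<lambda>n. bump x d n t) \<longlonglongrightarrow> indicator {x<..<x + d} t"
proof (cases "t \<in> {x<..<x + d}")
  case True
  define q where "q = (t - x) * (x + d - t)"
  have q: "q > 0" using True by (auto simp: q_def)
  have nq: "real n * ((t - x) * (x + d - t)) = real n * q" for n
    by (simp add: q_def)
  have "(\<lambda>n. exp (- ((1 / q) * (1 / real n)))) \<longlonglongrightarrow> exp (- ((1 / q) * 0))"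
    by (intro tendsto_intros lim_1_over_n)
  moreover have "\<forall>\<^sub>F n in sequentially. exp (- ((1 / q) * (1 / real n))) = bump x d n t"
    using eventually_gt_at_top[of 0]
    by eventually_elim (use q in \<open>simp add: bump_def expinv_def nq mult.commute\<close>)
  ultimately show ?thesis
    using True by (simp add: tendsto_cong)
next
  case False
  then show ?thesis
    using bump_eq_0[OF assms, of t x] by (auto simp: indicator_def)
qed

lemma integrable_bump: 
  assumes "d > 0"
  shows "integrable lborel (bump x d n)"
proof -
  have "integrable lborel (\<lambda>t. indicator {x..x + d} t *\<^sub>R bump x d n t)"
    by (rule borel_integrable_compact) (auto intro: continuous_bump)
  moreover have "indicator {x..x + d} t *\<^sub>R bump x d n t = bump x d n t" for t
    using bump_eq_0[OF assms, of t x n] by (cases "x \<le> t \<and> t \<le> x + d") auto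
  ultimately show ?thesis by (simp only:)
qed

definition bump_int :: "real \<Rightarrow> real \<Rightarrow> nat \<Rightarrow> real \<Rightarrow> real" where
  "bump_int x d n t = (LBINT s:{..t}. bump x d n s)"

lemma bump_int_has_derivative:
  assumes "d > 0"
  shows "(bump_int x d n has_real_derivative bump x d n t) (at t)"
proof -
  \<comment> \<open>\<open>c\<close> lies to the left of \<open>t\<close> and of the support, so
    near \<open>t\<close> the integral over the ray is an integral from the fixed point
    \<open>c\<close>.\<close>
  define c where "c = min t x - 1"
  have eq: "bump_int x d n u = integral {c..u} (bump x d n)" if "c < u" for u
  proof -
    have "indicator {..u} s *\<^sub>R bump x d n s = indicator {c..u} s *\<^sub>R bump x d n s" for s
      using bump_eq_0[OF assms, of s x n] that by (cases "s < c") (auto simp: indicator_def c_def min_def split: if_splits)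
    then have "bump_int x d n u = (LBINT s:{c..u}. bump x d n s)"
      by (simp only: bump_int_def set_lebesgue_integral_def)
    also have "set_integrable lborel {c..u} (bump x d n)"
      unfolding set_integrable_def by (rule borel_integrable_compact) (auto intro: continuous_bump)
    then have "(LBINT s:{c..u}. bump x d n s) = integral {c..u} (bump x d n)"
      by (rule set_borel_integral_eq_integral)
    finally show ?thesis .
  qed
  have "((\<lambda>u. integral {c..u} (bump x d n)) has_vector_derivative bump x d n t) (at t within {c..t+1})"
    by (rule integral_has_vector_derivative) (auto intro: continuous_bump simp: c_def)
  then have "((\<lambda>u. integral {c..u} (bump x d n)) has_real_derivative bump x d n t) (at t)"
    by (subst (asm) at_within_interior) (auto simp: has_real_derivative_iff_has_vector_derivative c_def)
  then show ?thesis
    by (rule has_field_derivative_transform_within_open[of _ _ _ "{c<..}"]) (auto simp: eq c_def)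
qed

lemma bump_int_le: "d > 0 \<Longrightarrow> t \<le> x \<Longrightarrow> bump_int x d n t = 0"
proof -
  assume "d > 0" "t \<le> x"
  then have "indicator {..t} s *\<^sub>R bump x d n s = 0" for s
    using bump_eq_0[of d s x n] by (auto simp: indicator_def)
  then show ?thesis
    unfolding bump_int_def set_lebesgue_integral_def by (simp only: integral_zero)
qed

text \<open>By translation invariance the final height is the same for every \<open>x\<close>. Hence
  the difference of two ramps vanishes to the right of both, which makes its support
  compact.\<close>

lemma bump_int_ge: 
  assumes "d > 0" "t \<ge> x + d"
  shows "bump_int x d n t = (LBINT s. bump 0 d n s)"
proof -
  have "indicator {..t} s *\<^sub>R bump x d n s = bump x d n s" for s
    using bump_eq_0[of d s x n] assms by (auto simp: indicator_def)
  then have "bump_int x d n t = (LBINT s. bump x d n s)"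
    unfolding bump_int_def set_lebesgue_integral_def by (simp only:)
  also have "\<dots> = (LBINT s. bump x d n (x + 1 * s))"
    using lborel_integral_real_affine[of 1 "bump x d n" x] by simp
  also have "(\<lambda>s. bump x d n (x + 1 * s)) = bump 0 d n"
    by (auto simp: bump_def algebra_simps)
  finally show ?thesis .
qed

text \<open>For positive \<open>d\<close> the limit of the ramps \<open>bump_int 0 d n\<close>:
  slope 1 up to height \<open>d\<close>, then constant.\<close>

definition clamp0 :: "real \<Rightarrow> real \<Rightarrow> real" where
  "clamp0 d t = max 0 (min t d)"

lemma bump_int_tendsto:
  assumes d: "d > 0"
  shows "(\<lambda>n. bump_int x d n t) \<longlonglongrightarrow> clamp0 d (t - x)"
proof -
  have "(\<lambda>n. LBINT s. indicator {..t} s *\<^sub>R bump x d n s) \<longlonglongrightarrow>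
      (LBINT s. indicator {..t} s *\<^sub>R indicator {x<..<x + d} s)"
  proof (rule integral_dominated_convergence[where w = "indicator {x..x + d}"])
    show "AE s in lborel. (\<lambda>n. indicator {..t} s *\<^sub>R bump x d n s) \<longlonglongrightarrow>
        indicator {..t} s *\<^sub>R indicator {x<..<x + d} s"
      by (intro AE_I2 tendsto_intros bump_tendsto d)
    show "AE s in lborel. norm (indicator {..t} s *\<^sub>R bump x d n s) \<le> indicator {x..x + d} s" for n
      using bump_eq_0[OF d, of _ x n] bump_bounds[of x d n] by (auto simp: indicator_def not_le)
    show "integrable lborel (indicator {x..x + d} :: real \<Rightarrow> real)"
      using d by (auto intro!: integrable_real_indicator)
  qed auto
  also have "(LBINT s. indicator {..t} s *\<^sub>R indicator {x<..<x + d} s) = clamp0 d (t - x)"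
  proof -
    have "(LBINT s. indicator {..t} s *\<^sub>R indicator {x<..<x + d} s) =
        (LBINT s. indicator ({..t} \<inter> {x<..<x + d}) s :: real)"
      by (rule Bochner_Integration.integral_cong) (auto simp: indicator_def)
    also have "\<dots> = measure lborel ({..t} \<inter> {x<..<x + d})" by simp
    also have "\<dots> = clamp0 d (t - x)"
    proof -
      consider "t \<le> x" | "x < t" "t < x + d" | "x + d \<le> t" by linarith
      then show ?thesis
      proof cases
        case 1
        then have "{..t} \<inter> {x<..<x + d} = {}" by auto
        then show ?thesis using 1 by (simp add: clamp0_def)
      next
        case 2
        then have "{..t} \<inter> {x<..<x + d} = {x<..t}" by auto
        then show ?thesis using 2 by (simp add: clamp0_def)
      next
        case 3
        then have "{..t} \<inter> {x<..<x + d} = {x<..<x+d}" by auto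
        then show ?thesis using 3 d by (simp add: clamp0_def)
      qed
    qed
    finally show ?thesis .
  qed
  finally show ?thesis
    by (simp add: bump_int_def set_lebesgue_integral_def)
qed

lemma bump_int_bounds: 
  assumes "d > 0"
  shows "0 \<le> bump_int x d n t" "bump_int x d n t \<le> d"
proof -
  show "0 \<le> bump_int x d n t"
    unfolding bump_int_def set_lebesgue_integral_def
    by (rule Bochner_Integration.integral_nonneg) (auto simp: bump_bounds)
  have "bump_int x d n t \<le> (LBINT s. indicator {x..x + d} s)"
    unfolding bump_int_def set_lebesgue_integral_def
  proof (rule integral_mono)
    show "integrable lborel (\<lambda>s. indicator {..t} s *\<^sub>R bump x d n s)"
      by (rule integrable_mult_indicator) (auto intro: integrable_bump assms)
    show "integrable lborel (indicator {x..x + d} :: real \<Rightarrow> real)"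
      using assms by (auto intro!: integrable_real_indicator)
  qed (use bump_eq_0[OF assms, of _ x n] bump_bounds[of x d n] in \<open>auto simp: indicator_def not_le\<close>)
  also have "\<dots> = d" using assms by simp
  finally show "bump_int x d n t \<le> d" .
qed

lemma bump_int_diff_test_function:
  assumes d: "d > 0" and xy: "x \<le> y" and sub: "{x..y + d} \<subseteq> einterval a b"
  shows "(\<lambda>t. bump_int x d n t - bump_int y d n t) \<in> test_functions a b"
proof -
  have D: "((\<lambda>t. bump_int x d n t - bump_int y d n t) has_real_derivative
      1 * bump x d n t + (-1) * bump y d n t) (at t)" for t
    using DERIV_diff[OF bump_int_has_derivative[OF d, of x n t] bump_int_has_derivative[OF d, of y n t]]
    by simp
  have "(\<lambda>t. 1 * bump x d n t + (-1) * bump y d n t) \<in> bump_space"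
    by (intro bump_space.add bump_in_bump_space)
  from antiderivative_bump_space_smooth[OF D this]
  have "\<forall>m. (deriv ^^ m) (\<lambda>t. bump_int x d n t - bump_int y d n t) differentiable_on UNIV"
    by blast
  moreover have "bump_int x d n t - bump_int y d n t = 0" if "t \<notin> {x..y + d}" for t
    using that d xy by (cases "t < x") (auto simp: bump_int_le bump_int_ge)
  ultimately show ?thesis
    using sub compact_Icc[of x "y + d"] unfolding test_functions_def by blast
qed

lemma deriv_bump_int_diff:
  assumes d: "d > 0"
  shows "deriv (\<lambda>t. bump_int x d n t - bump_int y d n t) t = bump x d n t - bump y d n t"
  by (intro DERIV_imp_deriv DERIV_diff bump_int_has_derivative d)

section \<open>Weak derivatives\<close>

lemma einterval_subset_cinterval: "einterval a b \<subseteq> cinterval a b"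
  by (auto simp: einterval_iff cinterval_def)

lemma einterval_Icc_subset:
  "x \<in> einterval a b \<Longrightarrow> y \<in> einterval a b \<Longrightarrow> {x..y} \<subseteq> einterval a b"
  by (auto simp: einterval_iff) (metis ereal_less_eq(3) less_le_trans, metis ereal_less_eq(3) le_less_trans)

lemma einterval_nbhd:
  assumes "x \<in> einterval a b"
  obtains e where "e > 0" "x - e \<in> einterval a b" "x + e \<in> einterval a b"
proof -
  obtain e where "e > 0" "cball x e \<subseteq> einterval a b"
    using assms open_einterval open_contains_cball by blast
  then show thesis
    by (intro that[of e]) (auto simp: dist_real_def subset_iff)
qed

lemma LBINT_Ioo_eq_Icc:
  fixes f :: "real \<Rightarrow> real"
  shows "x \<le> y \<Longrightarrow> (LBINT t:{x<..<y}. f t) = (LBINT t:{x..y}. f t)"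
  by (rule set_integral_discrete_difference[where X="{x, y}"]) auto

text \<open>Passes from smooth test functions to a piecewise linear one. Dominated convergence
  applies because the differences of bumps are bounded by 1 and those of ramps by \<open>d\<close>,
  while \<open>f\<close> and \<open>h\<close> are integrable on the compact interval that carries
  all of them.\<close>

lemma weak_deriv_trapezoid:
  assumes W: "has_weak_deriv a b f h" and d: "d > 0" and xy: "x \<le> y"
    and sub: "{x..y + d} \<subseteq> einterval a b"
  shows "(LBINT t:{x..x + d}. f t) - (LBINT t:{y..y + d}. f t) =
    - (LBINT t:{x..y + d}. h t * (clamp0 d (t - x) - clamp0 d (t - y)))"
proof -
  let ?K = "{x..y + d}" and ?E = "einterval a b"
  let ?\<phi> = "\<lambda>n t. bump_int x d n t - bump_int y d n t"
  let ?\<psi> = "\<lambda>n t. bump x d n t - bump y d n t"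
  have fK: "set_integrable lborel ?K f" and hK: "set_integrable lborel ?K h"
    using W sub compact_Icc unfolding has_weak_deriv_def locally_integrable_def by blast+
  define F where "F t = indicator ?K t *\<^sub>R f t" for t
  define H where "H t = indicator ?K t *\<^sub>R h t" for t
  have F: "integrable lborel F" and H: "integrable lborel H"
    using fK hK unfolding set_integrable_def F_def H_def by auto
  note [measurable] = borel_measurable_integrable[OF F] borel_measurable_integrable[OF H]
  have [measurable]: "bump_int z d n \<in> borel_measurable borel" for z n
    using bump_int_has_derivative[OF d]
    by (intro borel_measurable_continuous_onI continuous_at_imp_continuous_on) (blast intro: DERIV_isCont)
  have [measurable]: "(\<lambda>t. clamp0 d (t - z)) \<in> borel_measurable borel" for z
    unfolding clamp0_def by measurable
  have \<psi>0: "?\<psi> n t = 0" if "t \<notin> ?K" for n t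
    using that d xy by (cases "t < x") (auto simp: bump_eq_0)
  have \<phi>0: "?\<phi> n t = 0" if "t \<notin> ?K" for n t
    using that d xy by (cases "t < x") (auto simp: bump_int_le bump_int_ge)
  have eq: "(LBINT t. F t * ?\<psi> n t) = - (LBINT t. H t * ?\<phi> n t)" for n
  proof -
    have "(LBINT t:?E. f t * deriv (?\<phi> n) t) = - (LBINT t:?E. h t * ?\<phi> n t)"
      using W bump_int_diff_test_function[OF d xy sub, of n] unfolding has_weak_deriv_def by blast
    moreover have "(LBINT t:?E. f t * deriv (?\<phi> n) t) = (LBINT t. F t * ?\<psi> n t)"
      unfolding deriv_bump_int_diff[OF d] set_lebesgue_integral_def F_def
      by (rule Bochner_Integration.integral_cong) (use sub \<psi>0 in \<open>auto simp: indicator_def\<close>)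
    moreover have "(LBINT t:?E. h t * ?\<phi> n t) = (LBINT t. H t * ?\<phi> n t)"
      unfolding set_lebesgue_integral_def H_def
      by (rule Bochner_Integration.integral_cong) (use sub \<phi>0 in \<open>auto simp: indicator_def\<close>)
    ultimately show ?thesis by simp
  qed
  have "(\<lambda>n. LBINT t. F t * ?\<psi> n t) \<longlonglongrightarrow>
      (LBINT t. F t * (indicator {x<..<x + d} t - indicator {y<..<y + d} t))"
  proof (rule integral_dominated_convergence[where w = "\<lambda>t. \<bar>F t\<bar>"])
    show "AE t in lborel. norm (F t * ?\<psi> n t) \<le> \<bar>F t\<bar>" for n
    proof (rule AE_I2)
      fix t
      have "\<bar>?\<psi> n t\<bar> \<le> 1"
        using bump_bounds[of x d n t] bump_bounds[of y d n t] by linarith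
      then show "norm (F t * ?\<psi> n t) \<le> \<bar>F t\<bar>"
        by (simp add: abs_mult mult_left_le)
    qed
    show "AE t in lborel. (\<lambda>n. F t * ?\<psi> n t) \<longlonglongrightarrow>
        F t * (indicator {x<..<x + d} t - indicator {y<..<y + d} t)"
      by (intro AE_I2 tendsto_intros bump_tendsto d)
  qed (use F in auto)
  moreover have "(\<lambda>n. LBINT t. H t * ?\<phi> n t) \<longlonglongrightarrow>
      (LBINT t. H t * (clamp0 d (t - x) - clamp0 d (t - y)))"
  proof (rule integral_dominated_convergence[where w = "\<lambda>t. \<bar>H t\<bar> * d"])
    show "AE t in lborel. norm (H t * ?\<phi> n t) \<le> \<bar>H t\<bar> * d" for n
    proof (rule AE_I2)
      fix t
      have "\<bar>?\<phi> n t\<bar> \<le> d"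
        using bump_int_bounds[OF d, of x n t] bump_int_bounds[OF d, of y n t] by linarith
      then show "norm (H t * ?\<phi> n t) \<le> \<bar>H t\<bar> * d"
        by (simp add: abs_mult mult_left_mono)
    qed
    show "AE t in lborel. (\<lambda>n. H t * ?\<phi> n t) \<longlonglongrightarrow> H t * (clamp0 d (t - x) - clamp0 d (t - y))"
      by (intro AE_I2 tendsto_intros bump_int_tendsto d)
  qed (use H in auto)
  ultimately have "(LBINT t. F t * (indicator {x<..<x + d} t - indicator {y<..<y + d} t)) =
      - (LBINT t. H t * (clamp0 d (t - x) - clamp0 d (t - y)))"
    unfolding eq using LIMSEQ_unique tendsto_minus by blast
  moreover have "(LBINT t. F t * (indicator {x<..<x + d} t - indicator {y<..<y + d} t)) =
      (LBINT t:{x<..<x + d}. f t) - (LBINT t:{y<..<y + d}. f t)"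
  proof -
    have "set_integrable lborel {x<..<x + d} f" "set_integrable lborel {y<..<y + d} f"
      using xy d by (auto intro: set_integrable_subset[OF fK])
    then have "(LBINT t:{x<..<x + d}. f t) - (LBINT t:{y<..<y + d}. f t) =
        (LBINT t. indicator {x<..<x + d} t *\<^sub>R f t - indicator {y<..<y + d} t *\<^sub>R f t)"
      unfolding set_integrable_def set_lebesgue_integral_def
      by (rule Bochner_Integration.integral_diff[symmetric])
    also have "\<dots> = (LBINT t. F t * (indicator {x<..<x + d} t - indicator {y<..<y + d} t))"
      using xy d by (intro Bochner_Integration.integral_cong) (auto simp: F_def indicator_def)
    finally show ?thesis by simp
  qed
  ultimately show ?thesis
    using d LBINT_Ioo_eq_Icc[of x "x + d" f] LBINT_Ioo_eq_Icc[of y "y + d" f]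
    by (simp add: set_lebesgue_integral_def H_def mult.assoc)
qed

section \<open>Increments of weakly differentiable functions\<close>

lemma clamp0_scaled_tendsto:
  assumes S: "S \<longlonglongrightarrow> 0" "\<And>n. S n > 0"
  shows "(\<lambda>n. clamp0 (S n) u / S n) \<longlonglongrightarrow> indicator {0<..} u"
proof (cases "u > 0")
  case True
  have "\<forall>\<^sub>F n in sequentially. S n < u"
    using S(1) True by (rule order_tendstoD)
  then have "\<forall>\<^sub>F n in sequentially. clamp0 (S n) u / S n = 1"
  proof eventually_elim
    case (elim n)
    then show ?case using S(2)[of n] by (simp add: clamp0_def)
  qed
  then show ?thesis using True by (simp add: tendsto_eventually)
next
  case False
  then have "clamp0 (S n) u / S n = 0" for n
    using S(2)[of n] by (simp add: clamp0_def min_def)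
  then show ?thesis using False by (simp only: indicator_simps greaterThan_iff tendsto_const not_False_eq_True)
qed

text \<open>After division by \<open>d\<close> the trapezoid tends boundedly to the indicator of
  \<open>{x<..y}\<close>. No exceptional set appears yet: null sets enter only when the averages of
  \<open>f\<close> are replaced by its values.\<close>

lemma weak_deriv_increment_limit:
  assumes W: "has_weak_deriv a b f h" and xy: "x \<le> y"
    and E: "x \<in> einterval a b" "y \<in> einterval a b"
  shows "((\<lambda>d. ((LBINT t:{x..x + d}. f t) - (LBINT t:{y..y + d}. f t)) / d) \<longlongrightarrow>
    - (LBINT t:{x..y}. h t)) (at_right 0)"
proof -
  obtain e where e: "e > 0" "cball y e \<subseteq> einterval a b"
    using E(2) open_einterval open_contains_cball by blast
  define K where "K = {x..y + e}"
  have "y + e \<in> einterval a b"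
    using e by (auto simp: dist_real_def subset_iff)
  then have sub: "K \<subseteq> einterval a b"
    using E(1) einterval_Icc_subset unfolding K_def by blast
  have hK: "set_integrable lborel K h"
    using W sub unfolding has_weak_deriv_def locally_integrable_def K_def by blast
  define H where "H t = indicator K t *\<^sub>R h t" for t
  have H: "integrable lborel H"
    using hK unfolding set_integrable_def H_def .
  note [measurable] = borel_measurable_integrable[OF H]
  show ?thesis
  proof (rule tendsto_at_right_sequentially[OF e(1)])
    fix S :: "nat \<Rightarrow> real" assume S: "\<And>n. 0 < S n" "\<And>n. S n < e" "S \<longlonglongrightarrow> 0"
    have [measurable]: "(\<lambda>t. clamp0 (S n) (t - z)) \<in> borel_measurable borel" for z n
      unfolding clamp0_def by measurable
    have eq: "((LBINT t:{x..x + S n}. f t) - (LBINT t:{y..y + S n}. f t)) / S n =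
        - (LBINT t. H t * (clamp0 (S n) (t - x) / S n - clamp0 (S n) (t - y) / S n))" for n
    proof -
      have "{x..y + S n} \<subseteq> K" using S(2)[of n] by (auto simp: K_def)
      then have "(LBINT t:{x..x + S n}. f t) - (LBINT t:{y..y + S n}. f t) =
          - (LBINT t:{x..y + S n}. h t * (clamp0 (S n) (t - x) - clamp0 (S n) (t - y)))"
        using sub by (intro weak_deriv_trapezoid[OF W S(1) xy]) blast
      also have "(LBINT t:{x..y + S n}. h t * (clamp0 (S n) (t - x) - clamp0 (S n) (t - y))) =
          (LBINT t. H t * (clamp0 (S n) (t - x) - clamp0 (S n) (t - y)))"
        unfolding set_lebesgue_integral_def
        by (rule Bochner_Integration.integral_cong)
          (use S(1)[of n] S(2)[of n] xy in \<open>auto simp: H_def K_def indicator_def clamp0_def\<close>)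
      finally show ?thesis
        by (simp add: diff_divide_distrib[symmetric])
    qed
    have "(\<lambda>n. LBINT t. H t * (clamp0 (S n) (t - x) / S n - clamp0 (S n) (t - y) / S n)) \<longlonglongrightarrow>
        (LBINT t. H t * (indicator {0<..} (t - x) - indicator {0<..} (t - y)))"
    proof (rule integral_dominated_convergence[where w = "\<lambda>t. \<bar>H t\<bar>"])
      have bnd: "0 \<le> clamp0 (S n) u / S n" "clamp0 (S n) u / S n \<le> 1" for n u
        using S(1)[of n] by (auto simp: clamp0_def field_simps)
      show "AE t in lborel. norm (H t * (clamp0 (S n) (t - x) / S n - clamp0 (S n) (t - y) / S n)) \<le> \<bar>H t\<bar>" for n
      proof (rule AE_I2)
        fix t
        have "\<bar>clamp0 (S n) (t - x) / S n - clamp0 (S n) (t - y) / S n\<bar> \<le> 1"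
          using bnd[of n "t - x"] bnd[of n "t - y"] by linarith
        then show "norm (H t * (clamp0 (S n) (t - x) / S n - clamp0 (S n) (t - y) / S n)) \<le> \<bar>H t\<bar>"
          unfolding norm_mult by (simp only: real_norm_def mult_left_le abs_ge_zero)
      qed
      show "AE t in lborel. (\<lambda>n. H t * (clamp0 (S n) (t - x) / S n - clamp0 (S n) (t - y) / S n)) \<longlonglongrightarrow>
          H t * (indicator {0<..} (t - x) - indicator {0<..} (t - y))"
        by (intro AE_I2 tendsto_intros clamp0_scaled_tendsto S)
    qed (use H in auto)
    also have "(LBINT t. H t * (indicator {0<..} (t - x) - indicator {0<..} (t - y))) =
        (LBINT t:{x<..y}. h t)"
      unfolding set_lebesgue_integral_def
      by (rule Bochner_Integration.integral_cong)
        (use xy e in \<open>auto simp: H_def K_def indicator_def\<close>)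
    also have "\<dots> = (LBINT t:{x..y}. h t)"
      using xy by (intro set_integral_discrete_difference[where X="{x}"]) auto
    finally show "(\<lambda>n. ((LBINT t:{x..x + S n}. f t) - (LBINT t:{y..y + S n}. f t)) / S n) \<longlonglongrightarrow>
        - (LBINT t:{x..y}. h t)"
      unfolding eq by (rule tendsto_minus)
  qed
qed

text \<open>The boxes in \<open>integrable_ccontinuous_explicit\<close> have \<open>x\<close> as
  lower corner. In dimension one they are the intervals to the right of \<open>x\<close>, exactly
  the averages that the trapezoids produce.\<close>

lemma lebesgue_differentiation_integrable:
  fixes f :: "real \<Rightarrow> real"
  assumes f: "integrable lborel f"
  shows "AE x in lborel. ((\<lambda>d. (LBINT t:{x..x + d}. f t) / d) \<longlongrightarrow> f x) (at_right 0)"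
proof -
  have si: "set_integrable lborel {u..v} f" for u v
    unfolding set_integrable_def by (rule integrable_mult_indicator[OF _ f]) auto
  then have "f integrable_on cbox u v" for u v
    using set_borel_integral_eq_integral(1) by (metis interval_cbox)
  then obtain N where N: "negligible N"
    and lim: "\<And>x e. \<lbrakk>x \<notin> N; 0 < e\<rbrakk> \<Longrightarrow> \<exists>d>0. \<forall>h. 0 < h \<and> h < d \<longrightarrow>
      norm (integral (cbox x (x + h *\<^sub>R One)) f /\<^sub>R h ^ DIM(real) - f x) < e"
    by (rule integrable_ccontinuous_explicit) blast
  have "AE x in lebesgue. x \<notin> N"
    using N by (simp add: negligible_iff_null_sets AE_not_in)
  then have "AE x in lborel. x \<notin> N"
    by (simp add: AE_completion_iff)
  then show ?thesis
  proof eventually_elim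
    case (elim x)
    show ?case
    proof (rule tendstoI)
      fix e :: real assume "e > 0"
      from lim[OF elim this] obtain d where d: "d > 0" "\<And>h. 0 < h \<Longrightarrow> h < d \<Longrightarrow>
        norm (integral (cbox x (x + h *\<^sub>R One)) f /\<^sub>R h ^ DIM(real) - f x) < e" by blast
      have "dist ((LBINT t:{x..x + h}. f t) / h) (f x) < e" if "0 < h" "h < d" for h
        using d(2)[OF that] set_borel_integral_eq_integral(2)[OF si[of x "x + h"]]
        by (simp add: dist_real_def divide_inverse mult.commute)
      then show "\<forall>\<^sub>F h in at_right 0. dist ((LBINT t:{x..x + h}. f t) / h) (f x) < e"
        using d(1) by (auto simp: eventually_at_right_field)
    qed
  qed
qed

text \<open>Countably many cut-offs \<open>?f i\<close> cost only one null set, and near a given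
  point a late cut-off agrees with \<open>f\<close>.\<close>

lemma lebesgue_differentiation:
  assumes ab: "a < b" and f: "locally_integrable a b f"
  shows "AE x in lborel. x \<in> einterval a b \<longrightarrow>
    ((\<lambda>d. (LBINT t:{x..x + d}. f t) / d) \<longlongrightarrow> f x) (at_right 0)"
proof -
  from ab obtain u l :: "nat \<Rightarrow> real" where E: "einterval a b = (\<Union>i. {l i .. u i})"
    and mono: "incseq u" "decseq l"
    by (rule einterval_Icc_approximation)
  let ?f = "\<lambda>i t. indicator {l i..u i} t *\<^sub>R f t"
  have "integrable lborel (?f i)" for i
    using f E unfolding locally_integrable_def set_integrable_def by blast
  then have "AE x in lborel. \<forall>i. ((\<lambda>d. (LBINT t:{x..x + d}. ?f i t) / d) \<longlongrightarrow> ?f i x) (at_right 0)"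
    unfolding AE_all_countable using lebesgue_differentiation_integrable by blast
  then show ?thesis
  proof eventually_elim
    case (elim x)
    show ?case
    proof
      assume x: "x \<in> einterval a b"
      then obtain e where e: "e > 0" "cball x e \<subseteq> einterval a b"
        using open_einterval open_contains_cball by blast
      then have "x + e \<in> einterval a b" by (auto simp: dist_real_def subset_iff)
      then obtain i j where ij: "x \<in> {l i..u i}" "x + e \<in> {l j..u j}"
        using x unfolding E by blast
      \<comment> \<open>One interval of the exhaustion has to contain both \<open>x\<close> and
        \<open>x + e\<close>, so that averages over lengths below \<open>e\<close> do not see the
        cut-off.\<close>
      define k where "k = max i j"
      have "l k \<le> l i" "u j \<le> u k"
        using mono by (auto simp: k_def decseqD incseqD)
      then have k: "l k \<le> x" "x + e \<le> u k" using ij by auto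
      have "(LBINT t:{x..x + d}. ?f k t) = (LBINT t:{x..x + d}. f t)" if "d < e" for d
        unfolding set_lebesgue_integral_def
        by (rule Bochner_Integration.integral_cong) (use k that in \<open>auto simp: indicator_def\<close>)
      then have "\<forall>\<^sub>F d in at_right 0. (LBINT t:{x..x + d}. ?f k t) / d = (LBINT t:{x..x + d}. f t) / d"
        using e(1) by (auto simp: eventually_at_right_field)
      moreover have "?f k x = f x" using k e(1) by simp
      ultimately show "((\<lambda>d. (LBINT t:{x..x + d}. f t) / d) \<longlongrightarrow> f x) (at_right 0)"
        using elim[rule_format, of k] by (simp only: tendsto_cong)
    qed
  qed
qed

text \<open>A single null set serves all pairs: outside it the right averages of \<open>f\<close>
  converge to \<open>f\<close>. In this form the result can be used under a double integral.\<close>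

lemma weak_deriv_increment:
  assumes ab: "a < b" and W: "has_weak_deriv a b f h"
  obtains N where "N \<in> null_sets lborel"
    "\<And>x y. x \<in> einterval a b - N \<Longrightarrow> y \<in> einterval a b - N \<Longrightarrow> x \<le> y \<Longrightarrow>
      f y - f x = (LBINT t:{x..y}. h t)"
proof -
  have "locally_integrable a b f"
    using W by (simp add: has_weak_deriv_def)
  from lebesgue_differentiation[OF ab this] obtain N where N: "N \<in> null_sets lborel"
    "{x. \<not> (x \<in> einterval a b \<longrightarrow>
      ((\<lambda>d. (LBINT t:{x..x + d}. f t) / d) \<longlongrightarrow> f x) (at_right 0))} \<subseteq> N"
    by (auto simp: eventually_ae_filter)
  show thesis
  proof
    fix x y assume xy: "x \<in> einterval a b - N" "y \<in> einterval a b - N" "x \<le> y"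
    have "((\<lambda>d. (LBINT t:{x..x + d}. f t) / d - (LBINT t:{y..y + d}. f t) / d) \<longlongrightarrow> f x - f y) (at_right 0)"
      using N(2) xy by (intro tendsto_diff) auto
    moreover have "((\<lambda>d. (LBINT t:{x..x + d}. f t) / d - (LBINT t:{y..y + d}. f t) / d) \<longlongrightarrow>
        - (LBINT t:{x..y}. h t)) (at_right 0)"
      using weak_deriv_increment_limit[OF W xy(3)] xy by (simp add: diff_divide_distrib)
    ultimately have "f x - f y = - (LBINT t:{x..y}. h t)"
      by (rule tendsto_unique[rotated]) simp
    then show "f y - f x = (LBINT t:{x..y}. h t)" by simp
  qed (fact N(1))
qed

section \<open>Uniqueness and measurability of weak derivatives, and the classical case\<close>

lemma has_weak_deriv_weak_deriv:
  "has_weak_deriv a b f h \<Longrightarrow> has_weak_deriv a b f (weak_deriv a b f)"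
  unfolding weak_deriv_def by (rule someI[of "\<lambda>h. has_weak_deriv a b f h"])

text \<open>By \<open>weak_deriv_increment_limit\<close> both candidates have the same integral over
  every interval, hence the same averages. This identifies \<open>weak_deriv\<close>, which is a
  choice, with a classical derivative almost everywhere.\<close>

lemma weak_deriv_unique:
  assumes ab: "a < b" and W1: "has_weak_deriv a b f h1" and W2: "has_weak_deriv a b f h2"
  shows "AE x in lborel. x \<in> einterval a b \<longrightarrow> h1 x = h2 x"
proof -
  have eq: "(LBINT t:{x..y}. h1 t) = (LBINT t:{x..y}. h2 t)"
    if "x \<le> y" "x \<in> einterval a b" "y \<in> einterval a b" for x y
    using tendsto_unique[OF _ weak_deriv_increment_limit[OF W1 that] weak_deriv_increment_limit[OF W2 that]]
    by simp
  have "locally_integrable a b h1" "locally_integrable a b h2"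
    using W1 W2 by (auto simp: has_weak_deriv_def)
  from lebesgue_differentiation[OF ab this(1)] lebesgue_differentiation[OF ab this(2)]
  show ?thesis
  proof eventually_elim
    case (elim x)
    show ?case
    proof
      assume x: "x \<in> einterval a b"
      then obtain e where e: "e > 0" "cball x e \<subseteq> einterval a b"
        using open_einterval open_contains_cball by blast
      have "x + d \<in> einterval a b" if "0 < d" "d < e" for d
        using e that by (auto simp: dist_real_def subset_iff)
      then have "\<forall>\<^sub>F d in at_right 0. (LBINT t:{x..x + d}. h1 t) / d = (LBINT t:{x..x + d}. h2 t) / d"
        using e(1) x eq[of x] by (auto simp: eventually_at_right_field)
      then have "((\<lambda>d. (LBINT t:{x..x + d}. h1 t) / d) \<longlongrightarrow> h2 x) (at_right 0)"
        using elim(2) x by (simp only: tendsto_cong)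
      with elim(1) x show "h1 x = h2 x"
        by (auto intro: tendsto_unique[rotated])
    qed
  qed
qed

lemma continuous_imp_locally_integrable:
  "continuous_on (einterval a b) f \<Longrightarrow> locally_integrable a b f"
  unfolding locally_integrable_def set_integrable_def
  using borel_integrable_compact continuous_on_subset by blast

lemma compact_subset_einterval_Icc:
  assumes "a < b" "compact K" "K \<subseteq> einterval a b"
  obtains p q where "p \<in> einterval a b" "q \<in> einterval a b" "p \<le> q" "K \<subseteq> {p<..<q}"
proof -
  obtain c where c: "c \<in> einterval a b" using einterval_nonempty[OF assms(1)] by blast
  \<comment> \<open>Adding \<open>c\<close> keeps \<open>L\<close> nonempty when \<open>K\<close> is
    empty.\<close>
  define L where "L = insert c K"
  have L: "compact L" "L \<noteq> {}" "L \<subseteq> einterval a b" "K \<subseteq> L"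
    using assms c by (auto simp: L_def)
  obtain m where m: "m \<in> L" "\<And>t. t \<in> L \<Longrightarrow> m \<le> t"
    using compact_attains_inf[OF L(1,2)] by blast
  obtain M where M: "M \<in> L" "\<And>t. t \<in> L \<Longrightarrow> t \<le> M"
    using compact_attains_sup[OF L(1,2)] by blast
  have mM: "m \<in> einterval a b" "M \<in> einterval a b"
    using m(1) M(1) L(3) by auto
  obtain e where e: "e > 0" "m - e \<in> einterval a b"
    using mM(1) by (rule einterval_nbhd)
  obtain e' where e': "e' > 0" "M + e' \<in> einterval a b"
    using mM(2) by (rule einterval_nbhd)
  show thesis
  proof
    show "m - e \<in> einterval a b" "M + e' \<in> einterval a b"
      by fact+
    show "m - e \<le> M + e'" using m(2)[OF M(1)] e(1) e'(1) by simp
    show "K \<subseteq> {m - e<..<M + e'}"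
    proof
      fix t assume "t \<in> K"
      then have "t \<in> L" using L(4) by blast
      then show "t \<in> {m - e<..<M + e'}"
        using m(2)[of t] M(2)[of t] e(1) e'(1) by simp
    qed
  qed
qed

text \<open>Integration by parts on an interval \<open>{p..q}\<close> whose interior contains the
  support of the test function, so that the boundary terms vanish.\<close>

lemma C1_has_weak_deriv:
  assumes ab: "a < b"
    and D: "\<And>x. x \<in> einterval a b \<Longrightarrow> (g has_real_derivative g' x) (at x)"
    and cont: "continuous_on (einterval a b) g'"
  shows "has_weak_deriv a b g g'"
proof -
  let ?E = "einterval a b"
  have cg: "continuous_on ?E g"
    using D by (meson DERIV_isCont continuous_at_imp_continuous_on)
  have "(LBINT x:?E. g x * deriv \<phi> x) = - (LBINT x:?E. g' x * \<phi> x)" if \<phi>: "\<phi> \<in> test_functions a b" for \<phi>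
  proof -
    from \<phi> obtain K where K: "compact K" "K \<subseteq> ?E" "\<And>x. x \<notin> K \<Longrightarrow> \<phi> x = 0"
      by (auto simp: test_functions_def)
    have smooth: "(deriv ^^ n) \<phi> differentiable_on UNIV" for n
      using \<phi> by (auto simp: test_functions_def)
    obtain p q where pq: "p \<in> ?E" "q \<in> ?E" "p \<le> q" "K \<subseteq> {p<..<q}"
      using compact_subset_einterval_Icc[OF ab K(1,2)] by blast
    have sub: "{p..q} \<subseteq> ?E" using pq einterval_Icc_subset by blast
    have D\<phi>: "(\<phi> has_real_derivative deriv \<phi> x) (at x)" for x
      using smooth[of 0] by (auto simp: differentiable_on_def DERIV_deriv_iff_real_differentiable)
    have c\<phi>: "continuous_on S \<phi>" for S
      using D\<phi> by (meson DERIV_isCont continuous_at_imp_continuous_on)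
    have c\<phi>': "continuous_on S (deriv \<phi>)" for S
      using differentiable_imp_continuous_on[OF smooth[of 1]] continuous_on_subset by fastforce
    \<comment> \<open>The complement of \<open>K\<close> is open, so \<open>\<phi>\<close> vanishes
      near \<open>x\<close> and its derivative at \<open>x\<close> is 0 as well.\<close>
    have z: "\<phi> x = 0" "deriv \<phi> x = 0" if "x \<notin> {p<..<q}" "x \<notin> K" for x
    proof -
      show "\<phi> x = 0" using K(3) that by blast
      have "open (- K)" using K(1) by (simp add: compact_imp_closed open_Compl)
      then have "((\<lambda>_. 0) has_real_derivative deriv \<phi> x) (at x)"
        by (intro has_field_derivative_transform_within_open[OF D\<phi>, of "- K" x "\<lambda>_. 0"]) (use K(3) that(2) in auto)
      then show "deriv \<phi> x = 0" using DERIV_unique DERIV_const by blast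
    qed
    have z': "\<phi> x = 0" "deriv \<phi> x = 0" if "x \<notin> {p<..<q}" for x
      using z[OF that] pq(4) that by blast+
    have int: "integrable lborel (\<lambda>x. indicator {p..q} x *\<^sub>R u x)" if "continuous_on {p..q} u" for u :: "real \<Rightarrow> real"
      by (rule borel_integrable_compact[OF compact_Icc that])
    have cc: "continuous_on {p..q} (\<lambda>x. g x * deriv \<phi> x)" "continuous_on {p..q} (\<lambda>x. g' x * \<phi> x)"
      using cg cont sub c\<phi> c\<phi>' by (auto intro!: continuous_on_mult intro: continuous_on_subset)
    have "(LBINT x:?E. g x * deriv \<phi> x) + (LBINT x:?E. g' x * \<phi> x) =
      (LBINT x. indicator {p..q} x *\<^sub>R (g x * deriv \<phi> x)) + (LBINT x. indicator {p..q} x *\<^sub>R (g' x * \<phi> x))"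
      unfolding set_lebesgue_integral_def
      by (intro arg_cong2[where f = "(+)"] Bochner_Integration.integral_cong)
        (use sub z' in \<open>auto simp: indicator_def\<close>)
    also have "\<dots> = (LBINT x. (g x * deriv \<phi> x + g' x * \<phi> x) * indicator {p..q} x)"
      using int[OF cc(1)] int[OF cc(2)]
      by (subst Bochner_Integration.integral_add[symmetric]) (auto simp: algebra_simps)
    also have "\<dots> = g q * \<phi> q - g p * \<phi> p"
    proof (rule integral_FTC_Icc_real[OF pq(3), of "\<lambda>x. g x * \<phi> x"])
      fix x assume "p \<le> x" "x \<le> q"
      then have "x \<in> ?E" using sub by auto
      then show "((\<lambda>x. g x * \<phi> x) has_real_derivative g x * deriv \<phi> x + g' x * \<phi> x) (at x)"
        using DERIV_mult[OF D D\<phi>, of x] by (simp add: algebra_simps)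
      show "isCont (\<lambda>x. g x * deriv \<phi> x + g' x * \<phi> x) x"
        using \<open>x \<in> ?E\<close> cg cont c\<phi>[of UNIV] c\<phi>'[of UNIV]
        by (auto intro!: continuous_intros simp: continuous_on_eq_continuous_at)
    qed
    also have "\<dots> = 0" using z' by simp
    finally show ?thesis by simp
  qed
  then show ?thesis
    using continuous_imp_locally_integrable cg cont by (auto simp: has_weak_deriv_def)
qed

text \<open>Integrability on compact sets gives measurability only piece by piece; along an
  exhaustion the pieces converge pointwise to \<open>f\<close> cut to the whole interval.\<close>

lemma locally_integrable_borel_measurable:
  assumes ab: "a < b" and f: "locally_integrable a b f"
  shows "(\<lambda>x. indicator (einterval a b) x * f x) \<in> borel_measurable borel"
proof -
  from ab obtain u l :: "nat \<Rightarrow> real" where E: "einterval a b = (\<Union>i. {l i .. u i})"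
    and mono: "incseq u" "decseq l"
    by (rule einterval_Icc_approximation)
  have inc: "{l i..u i} \<subseteq> {l j..u j}" if "i \<le> j" for i j
    using mono that by (auto simp: incseq_def decseq_def intro: order_trans)
  show ?thesis
  proof (rule borel_measurable_LIMSEQ_real)
    show "(\<lambda>x. indicator {l i..u i} x *\<^sub>R f x) \<in> borel_measurable borel" for i
    proof -
      have "set_integrable lborel {l i..u i} f"
        using f E compact_Icc unfolding locally_integrable_def by blast
      then show ?thesis
        unfolding set_integrable_def using borel_measurable_integrable by force
    qed
    fix x
    show "(\<lambda>i. indicator {l i..u i} x *\<^sub>R f x) \<longlonglongrightarrow> indicator (einterval a b) x * f x"
    proof (cases "x \<in> einterval a b")
      case True
      then obtain i where "x \<in> {l i..u i}" using E by blast
      then have "indicator {l j..u j} x *\<^sub>R f x = indicator (einterval a b) x * f x" if "j \<ge> i" for j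
        using True inc[OF that] by (auto simp: indicator_def)
      then show ?thesis
        by (intro tendsto_eventually) (auto simp: eventually_sequentially)
    next
      case False
      then have "indicator {l i..u i} x *\<^sub>R f x = 0" for i using E by (auto simp: indicator_def)
      then show ?thesis using False by (simp only: indicator_simps mult_zero_left tendsto_const not_False_eq_True)
    qed
  qed
qed

lemma integral_pos_of_pos_on_interval:
  fixes v :: "real \<Rightarrow> real"
  assumes v: "integrable lborel v" "\<And>x. v x \<ge> 0" and pq: "p < q" "\<And>x. p < x \<Longrightarrow> x < q \<Longrightarrow> v x > 0"
  shows "(LBINT x. v x) > 0"
proof (rule ccontr)
  assume "\<not> ?thesis"
  then have "(LBINT x. v x) = 0"
    using Bochner_Integration.integral_nonneg[of lborel v] v(2) by fastforce
  then have "AE x in lborel. v x = 0"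
    using integral_nonneg_eq_0_iff_AE[OF v(1)] v(2) by auto
  then have "AE x in lborel. x \<notin> {p<..<q}"
    by eventually_elim (use pq(2) in force)
  then have "{p<..<q} \<in> null_sets lborel"
    by (subst (asm) AE_iff_null_sets[symmetric]) auto
  then show False
    using pq(1) by (auto simp: null_sets_def)
qed

section \<open>The weighted Poincare inequality\<close>

text \<open>Cauchy--Schwarz for the factors h / sqrt g' and sqrt g'. The bound lives in
  \<open>ennreal\<close> because h^2 / g' may fail to be integrable; the right-hand side is then
  infinite, since the integral of \<open>g'\<close> is positive.\<close>

lemma cauchy_schwarz_Ioo:
  fixes h g' :: "real \<Rightarrow> real"
  assumes h: "set_integrable lborel {y<..<x} h" and g': "set_integrable lborel {y<..<x} g'"
    and pos: "\<And>z. y < z \<Longrightarrow> z < x \<Longrightarrow> g' z > 0" and B: "(LBINT z:{y<..<x}. g' z) > 0"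
  shows "ennreal ((LBINT z:{y<..<x}. h z)\<^sup>2) \<le>
    ennreal (LBINT z:{y<..<x}. g' z) * (\<integral>\<^sup>+z. indicator {y<..<x} z * ennreal ((h z)\<^sup>2 / g' z) \<partial>lborel)"
proof -
  let ?i = "\<lambda>z. indicator {y<..<x} z :: real"
  define B where "B = (LBINT z:{y<..<x}. g' z)"
  define c where "c = (LBINT z:{y<..<x}. h z)"
  let ?p = "\<lambda>z. ?i z * ((h z)\<^sup>2 / g' z)"
  have [measurable]: "(\<lambda>z. ?i z * h z) \<in> borel_measurable borel" "(\<lambda>z. ?i z * g' z) \<in> borel_measurable borel"
    using borel_measurable_integrable[OF h[unfolded set_integrable_def]]
      borel_measurable_integrable[OF g'[unfolded set_integrable_def]] by simp_all
  \<comment> \<open>Only the cut-off functions are known to be measurable. Outside the interval the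
    quotient is 0/0 = 0, which is also the value of \<open>?p\<close>.\<close>
  have "(\<lambda>z. (?i z * h z)\<^sup>2 / (?i z * g' z)) \<in> borel_measurable borel" by measurable
  also have "(\<lambda>z. (?i z * h z)\<^sup>2 / (?i z * g' z)) = ?p"
    by (auto simp: indicator_def)
  finally have [measurable]: "?p \<in> borel_measurable borel" .
  have p0: "?p z \<ge> 0" for z
    using pos[of z] by (auto simp: indicator_def)
  have eq: "(\<integral>\<^sup>+z. indicator {y<..<x} z * ennreal ((h z)\<^sup>2 / g' z) \<partial>lborel) = (\<integral>\<^sup>+z. ennreal (?p z) \<partial>lborel)"
    by (rule nn_integral_cong) (auto simp: indicator_def)
  show ?thesis
  proof (cases "(\<integral>\<^sup>+z. ennreal (?p z) \<partial>lborel) = \<infinity>")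
    case True
    then show ?thesis
      using B unfolding eq by (simp add: ennreal_mult_top)
  next
    case False
    then have p: "integrable lborel ?p"
    proof (intro integrableI_nonneg)
      show "(\<integral>\<^sup>+z. ennreal (?p z) \<partial>lborel) < \<infinity>"
        using False unfolding infinity_ennreal_def by (simp only: top.not_eq_extremum)
    qed (use p0 in \<open>simp_all only: AE_I2 measurable_lborel2 \<open>?p \<in> borel_measurable borel\<close>\<close>)
    define A where "A = (LBINT z. ?p z)"
    \<comment> \<open>the integrand is \<open>(B h - c g')\<^sup>2 / g'\<close>\<close>
    have "0 \<le> (LBINT z. B\<^sup>2 * ?p z - 2 * B * c * (?i z *\<^sub>R h z) + c\<^sup>2 * (?i z *\<^sub>R g' z))"
    proof (rule Bochner_Integration.integral_nonneg)
      fix z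
      show "0 \<le> B\<^sup>2 * ?p z - 2 * B * c * (?i z *\<^sub>R h z) + c\<^sup>2 * (?i z *\<^sub>R g' z)"
      proof (cases "z \<in> {y<..<x}")
        case True
        then have "g' z > 0" using pos by auto
        then have "B\<^sup>2 * ((h z)\<^sup>2 / g' z) - 2 * B * c * h z + c\<^sup>2 * g' z = (B * h z - c * g' z)\<^sup>2 / g' z"
          by (simp add: field_simps power2_eq_square)
        then show ?thesis using True \<open>g' z > 0\<close> by simp
      qed simp
    qed
    also have "\<dots> = B\<^sup>2 * A - 2 * B * c * c + c\<^sup>2 * B"
    proof -
      have "(LBINT z. B\<^sup>2 * P z - 2 * B * c * H z + c\<^sup>2 * Q z) =
          B\<^sup>2 * (LBINT z. P z) - 2 * B * c * (LBINT z. H z) + c\<^sup>2 * (LBINT z. Q z)"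
        if "integrable lborel P" "integrable lborel H" "integrable lborel Q" for P H Q :: "real \<Rightarrow> real"
        using that by simp
      from this[OF p h[unfolded set_integrable_def] g'[unfolded set_integrable_def]] show ?thesis
        by (simp only: A_def B_def c_def set_lebesgue_integral_def)
    qed
    also have "\<dots> = B * (B * A - c\<^sup>2)"
      by (simp add: power2_eq_square algebra_simps)
    finally have "c\<^sup>2 \<le> B * A"
      using B by (simp add: B_def zero_le_mult_iff)
    moreover have "(\<integral>\<^sup>+z. ennreal (?p z) \<partial>lborel) = ennreal A"
      unfolding A_def using p p0 by (intro nn_integral_eq_integral) auto
    ultimately show ?thesis
      using B unfolding eq by (simp add: B_def[symmetric] c_def[symmetric] ennreal_mult'[symmetric] ennreal_leI)
  qed
qed

lemma integrable_of_bool_mult: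
  fixes v :: "real \<Rightarrow> real"
  assumes "integrable lborel v" "Measurable.pred borel P"
  shows "integrable lborel (\<lambda>x. of_bool (P x) * v x)"
proof -
  have "integrable lborel (\<lambda>x. indicator {x. P x} x *\<^sub>R v x)"
    using assms by (intro integrable_mult_indicator) auto
  then show ?thesis by (simp add: indicator_def of_bool_def)
qed

lemma integral_split_at:
  fixes v :: "real \<Rightarrow> real"
  assumes v: "integrable lborel v"
  shows "(LBINT y. of_bool (y < x) * v y) + (LBINT y. of_bool (x < y) * v y) = (LBINT y. v y)"
proof -
  have "(LBINT y. of_bool (y < x) * v y) + (LBINT y. of_bool (x < y) * v y) =
      (LBINT y. of_bool (y < x) * v y + of_bool (x < y) * v y)"
    by (intro Bochner_Integration.integral_add[symmetric] integrable_of_bool_mult v) auto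
  also have "\<dots> = (LBINT y. v y)"
    by (rule integral_discrete_difference[where X = "{x}"]) auto
  finally show ?thesis .
qed

text \<open>\<open>g'\<close> is a parameter of its own so that \<open>s * g\<close> and
  \<open>s * deriv_on a b g\<close> can be inserted with s = 1 or s = -1, which covers increasing
  and decreasing functions at once.\<close>

locale increasing_centered =
  fixes a b :: ereal and \<mu> :: "real measure" and \<rho> g g' :: "real \<Rightarrow> real"
  assumes ab: "a < b"
    and density: "prob_with_density a b \<mu> \<rho>"
    and centered: "centered \<mu> g"
    and g_deriv: "x \<in> cinterval a b \<Longrightarrow> (g has_real_derivative g' x) (at x within cinterval a b)"
    and g'_cont: "continuous_on (cinterval a b) g'"
    and g'_pos: "x \<in> einterval a b \<Longrightarrow> g' x > 0"
begin

section \<open>Integrals against \<open>\<mu>\<close> as integrals over the real line\<close>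

abbreviation "E \<equiv> einterval a b"
abbreviation "I \<equiv> cinterval a b"

lemma E_subset_I: "E \<subseteq> I"
  by (rule einterval_subset_cinterval)

text \<open>A finite superset suffices for what follows. At an infinite end
  \<open>real_of_ereal\<close> is 0, which only enlarges it.\<close>

lemma I_minus_E: "I - E \<subseteq> {real_of_ereal a, real_of_ereal b}"
  by (auto simp: einterval_iff cinterval_def)

lemma borel_I [measurable]: "I \<in> sets borel"
  unfolding cinterval_def by measurable

lemma rho_cont: "continuous_on I \<rho>"
  using density by (simp add: prob_with_density_def C01_pos_def)

lemma rho_pos: "x \<in> I \<Longrightarrow> \<rho> x > 0"
  using density unfolding prob_with_density_def C01_pos_def
  by (cases "x \<in> E") (auto simp: cinterval_def einterval_iff)

text \<open>Extension by 0 turns integrals against \<open>\<mu>\<close> into integrals over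
  \<open>lborel\<close>, where Tonelli is applied. Leaving out the endpoints changes only a null
  set.\<close>

definition r :: "real \<Rightarrow> real" where
  "r x = indicator E x * \<rho> x"

lemma r_nonneg: "r x \<ge> 0"
  using rho_pos E_subset_I by (auto simp: r_def indicator_def intro: less_imp_le)

lemma r_eq_0: "x \<notin> E \<Longrightarrow> r x = 0"
  by (simp add: r_def)

lemma r_pos: "x \<in> E \<Longrightarrow> r x > 0"
  using rho_pos E_subset_I by (auto simp: r_def)

lemma r_measurable [measurable]: "r \<in> borel_measurable borel"
  using borel_measurable_continuous_on_indicator[OF _ continuous_on_subset[OF rho_cont E_subset_I]]
  by (simp add: r_def[abs_def])

lemma mu_measurable_iff:
  fixes u :: "real \<Rightarrow> real"
  shows "u \<in> borel_measurable \<mu> \<longleftrightarrow> (\<lambda>x. indicator E x * u x) \<in> borel_measurable borel"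
proof -
  have "u \<in> borel_measurable \<mu> \<longleftrightarrow> u \<in> borel_measurable (restrict_space lborel I)"
    using density by (simp add: prob_with_density_def)
  also have "\<dots> \<longleftrightarrow> (\<lambda>x. indicator I x *\<^sub>R u x) \<in> borel_measurable borel"
    by (subst borel_measurable_restrict_space_iff) auto
  also have "\<dots> \<longleftrightarrow> (\<lambda>x. indicator E x * u x) \<in> borel_measurable borel"
  proof
    assume "(\<lambda>x. indicator I x *\<^sub>R u x) \<in> borel_measurable borel"
    then have "(\<lambda>x. indicator E x * (indicator I x *\<^sub>R u x)) \<in> borel_measurable borel"
      by measurable
    also have "(\<lambda>x. indicator E x * (indicator I x *\<^sub>R u x)) = (\<lambda>x. indicator E x * u x)"
      using E_subset_I by (auto simp: indicator_def fun_eq_iff)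
    finally show "(\<lambda>x. indicator E x * u x) \<in> borel_measurable borel" .
  next
    assume "(\<lambda>x. indicator E x * u x) \<in> borel_measurable borel"
    then show "(\<lambda>x. indicator I x *\<^sub>R u x) \<in> borel_measurable borel"
      by (rule measurable_discrete_difference[where X = "I - E"])
        (use E_subset_I I_minus_E in \<open>auto simp: indicator_def intro: countable_finite finite_subset\<close>)
  qed
  finally show ?thesis .
qed

lemma mu_integral:
  fixes u :: "real \<Rightarrow> real"
  assumes u: "u \<in> borel_measurable \<mu>"
  shows mu_integrable_iff: "integrable \<mu> u \<longleftrightarrow> integrable lborel (\<lambda>x. r x * u x)"
    and mu_integral_eq: "(\<integral>x. u x \<partial>\<mu>) = (LBINT x. r x * u x)"
proof -
  let ?M = "restrict_space lborel I"
  have mu: "\<mu> = density ?M (\<lambda>x. ennreal (\<rho> x))"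
    using density by (simp add: prob_with_density_def)
  have [measurable]: "u \<in> borel_measurable ?M"
    using u mu by simp
  have "\<rho> \<in> borel_measurable (restrict_space borel I)"
    by (rule borel_measurable_continuous_on_restrict[OF rho_cont])
  then have [measurable]: "\<rho> \<in> borel_measurable ?M"
    using measurable_cong_sets[OF sets_restrict_space_cong[OF sets_lborel] refl] by blast
  have rho0: "AE x in ?M. 0 \<le> \<rho> x"
    using rho_pos by (intro AE_I2) (auto simp: space_restrict_space less_imp_le)
  have X: "countable (I - E)"
    using I_minus_E by (auto intro: countable_finite finite_subset)
  have eq: "indicator I x *\<^sub>R (\<rho> x *\<^sub>R u x) = r x * u x" if "x \<notin> I - E" for x
    using that E_subset_I by (auto simp: r_def indicator_def)
  have "integrable \<mu> u \<longleftrightarrow> integrable lborel (\<lambda>x. indicator I x *\<^sub>R (\<rho> x *\<^sub>R u x))"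
    unfolding mu by (subst integrable_density) (auto simp: rho0 integrable_restrict_space)
  also have "\<dots> \<longleftrightarrow> integrable lborel (\<lambda>x. r x * u x)"
    by (rule integrable_discrete_difference[OF X]) (use eq in auto)
  finally show "integrable \<mu> u \<longleftrightarrow> integrable lborel (\<lambda>x. r x * u x)" .
  have "(\<integral>x. u x \<partial>\<mu>) = (LBINT x. indicator I x *\<^sub>R (\<rho> x *\<^sub>R u x))"
    unfolding mu by (subst integral_density) (auto simp: rho0 integral_restrict_space)
  also have "\<dots> = (LBINT x. r x * u x)"
    by (rule integral_discrete_difference[OF X]) (use eq in auto)
  finally show "(\<integral>x. u x \<partial>\<mu>) = (LBINT x. r x * u x)" .
qed

lemma r_integrable: "integrable lborel r" and r_integral: "(LBINT x. r x) = 1"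
proof -
  interpret prob_space \<mu> using density unfolding prob_with_density_def by blast
  show "integrable lborel r" "(LBINT x. r x) = 1"
    using mu_integral[of "\<lambda>_. 1"] prob_space by auto
qed

lemma rg_integrable: "integrable lborel (\<lambda>x. r x * g x)" and rg_integral: "(LBINT x. r x * g x) = 0"
proof -
  have "g \<in> borel_measurable \<mu>" "integrable \<mu> g" "(\<integral>x. g x \<partial>\<mu>) = 0"
    using centered by (auto simp: centered_def)
  then show "integrable lborel (\<lambda>x. r x * g x)" "(LBINT x. r x * g x) = 0"
    using mu_integral[of g] by auto
qed

lemma g_deriv_at: "x \<in> E \<Longrightarrow> (g has_real_derivative g' x) (at x)"
proof -
  assume x: "x \<in> E"
  then have "x \<in> interior I"
    using E_subset_I open_einterval by (meson interiorI)
  then show ?thesis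
    using g_deriv[of x] interior_subset[of I] by (metis at_within_interior subsetD)
qed

lemma g_strict_mono: "x \<in> E \<Longrightarrow> y \<in> E \<Longrightarrow> x < y \<Longrightarrow> g x < g y"
  using g_deriv_at g'_pos einterval_Icc_subset[of x a b y]
  by (intro DERIV_pos_imp_increasing[of x y g]) (auto simp: subset_iff)

lemma g_mono: "x \<in> E \<Longrightarrow> y \<in> E \<Longrightarrow> x \<le> y \<Longrightarrow> g x \<le> g y"
  using g_strict_mono[of x y] by (cases "x = y") auto

text \<open>Nothing is known about \<open>g\<close> outside \<open>[a,b]\<close>, not even
  measurability; this cut-off is Borel on the whole line and may enter the product
  integrals.\<close>

definition gE :: "real \<Rightarrow> real" where "gE x = indicator E x * g x"

lemma gE_measurable [measurable]: "gE \<in> borel_measurable borel"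
  using centered mu_measurable_iff[of g] borel_measurable_integrable[of \<mu> g]
  unfolding gE_def[abs_def] centered_def by blast

lemma r_gE: "r x * gE x = r x * g x"
  by (simp add: r_def gE_def indicator_def)

lemma g'E_measurable [measurable]: "(\<lambda>x. indicator E x * g' x) \<in> borel_measurable borel"
  using borel_measurable_continuous_on_indicator[OF _ continuous_on_subset[OF g'_cont E_subset_I]]
  by simp

text \<open>Written with \<open>of_bool\<close> instead of an interval integral, so that it is
  defined on all reals and its measurability is that of a parameter integral.\<close>

definition G :: "real \<Rightarrow> real" where
  "G x = (LBINT y. of_bool (y < x) * (r y * g y))"

text \<open>This is the weight on \<open>E\<close> only. At a finite endpoint \<open>G\<close> is 0,
  hence so is \<open>wt\<close>, which need not be the limit from inside.\<close>

definition wt :: "real \<Rightarrow> real" where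
  "wt x = - (1 / (g' x * \<rho> x)) * G x"

text \<open>If g z <= 0, then \<open>g\<close> is negative to the left of \<open>z\<close>.
  Otherwise \<open>g\<close> is positive to the right of \<open>z\<close>, and since
  \<open>g\<close> is centered, \<open>G z\<close> is minus the integral over that side.\<close>

lemma G_neg:
  assumes z: "z \<in> E"
  shows "G z < 0"
proof -
  obtain e where e: "e > 0" "z - e \<in> E" "z + e \<in> E"
    using z by (rule einterval_nbhd)
  have nbhd: "x \<in> E" if "z - e < x" "x < z + e" for x
    using einterval_Icc_subset[OF e(2,3)] that by auto
  show ?thesis
  proof (cases "g z \<le> 0")
    case True
    have "(LBINT y. of_bool (y < z) * (r y * - g y)) > 0"
    proof (rule integral_pos_of_pos_on_interval[of _ "z - e" z])
      show "integrable lborel (\<lambda>y. of_bool (y < z) * (r y * - g y))"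
        using rg_integrable by (intro integrable_of_bool_mult) auto
      show "0 \<le> of_bool (y < z) * (r y * - g y)" for y
        using g_strict_mono[of y z] z True r_nonneg[of y] by (cases "y \<in> E") (auto simp: r_def intro: mult_nonneg_nonpos)
      show "0 < of_bool (y < z) * (r y * - g y)" if "z - e < y" "y < z" for y
        using that nbhd[of y] e(1) r_pos[of y] g_strict_mono[of y z] z True by (auto simp: mult_less_0_iff)
    qed (use e in auto)
    then show ?thesis by (simp add: G_def)
  next
    case False
    have "(LBINT y. of_bool (z < y) * (r y * g y)) > 0"
    proof (rule integral_pos_of_pos_on_interval[of _ z "z + e"])
      show "integrable lborel (\<lambda>y. of_bool (z < y) * (r y * g y))"
        using rg_integrable by (intro integrable_of_bool_mult) auto
      show "0 \<le> of_bool (z < y) * (r y * g y)" for y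
        using g_strict_mono[of z y] z False r_nonneg[of y] by (cases "y \<in> E") (auto simp: r_def)
      show "0 < of_bool (z < y) * (r y * g y)" if "z < y" "y < z + e" for y
        using that nbhd[of y] e(1) r_pos[of y] g_strict_mono[of z y] z False by auto
    qed (use e in auto)
    moreover have "G z + (LBINT y. of_bool (z < y) * (r y * g y)) = 0"
      using integral_split_at[OF rg_integrable, of z] rg_integral by (simp add: G_def)
    ultimately show ?thesis by simp
  qed
qed

lemma wt_pos: "z \<in> E \<Longrightarrow> wt z > 0"
  using G_neg[of z] g'_pos[of z] rho_pos[of z] E_subset_I
  by (auto simp: wt_def field_simps zero_less_mult_iff mult_less_0_iff)

lemma wt_eq: "z \<in> E \<Longrightarrow> wt z * g' z * r z = - G z"
  using g'_pos[of z] rho_pos[of z] E_subset_I by (auto simp: wt_def r_def)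

lemma G_measurable [measurable]: "G \<in> borel_measurable borel"
proof -
  have "(\<lambda>x. LBINT y. of_bool (y < x) * (r y * gE y)) \<in> borel_measurable borel"
    by measurable
  then show ?thesis by (simp add: G_def[abs_def] r_gE)
qed

lemma wt_measurable [measurable]: "(\<lambda>x. indicator E x * wt x) \<in> borel_measurable borel"
proof -
  have "(\<lambda>x. - (indicator E x / ((indicator E x * g' x) * r x)) * G x) \<in> borel_measurable borel"
    by measurable
  also have "(\<lambda>x. - (indicator E x / ((indicator E x * g' x) * r x)) * G x) = (\<lambda>x. indicator E x * wt x)"
    by (auto simp: wt_def r_def indicator_def)
  finally show ?thesis .
qed

text \<open>Let M be the mass to the left of \<open>z\<close>. The mass to the right is 1 - M and
  the integral of \<open>g\<close> there is - G z, so the double integral is M (- G z) - (1 - M) G z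
  = - G z.\<close>

lemma inner_integral:
  assumes z: "z \<in> E"
  shows "(\<integral>\<^sup>+x. \<integral>\<^sup>+y. ennreal (r x * r y * (gE x - gE y)) * of_bool (y < z \<and> z < x) \<partial>lborel \<partial>lborel) =
    ennreal (- G z)"
proof -
  define M where "M = (LBINT y. of_bool (y < z) * r y)"
  have rgE: "integrable lborel (\<lambda>x. r x * gE x)" and GE: "G z = (LBINT y. of_bool (y < z) * (r y * gE y))"
    using rg_integrable by (simp_all add: r_gE G_def)
  have int: "integrable lborel (\<lambda>y. of_bool (y < z) * r y)" "integrable lborel (\<lambda>y. of_bool (y < z) * (r y * gE y))"
    "integrable lborel (\<lambda>x. of_bool (z < x) * r x)" "integrable lborel (\<lambda>x. of_bool (z < x) * (r x * gE x))"
    by (intro integrable_of_bool_mult r_integrable rgE; simp)+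
  \<comment> \<open>Each term is a product of a function of \<open>x\<close> and a function of
    \<open>y\<close>. Only their difference is nonnegative, so it is integrated as a real function
    before returning to \<open>ennreal\<close>.\<close>
  let ?F = "\<lambda>x y. of_bool (z < x) * r x * gE x * (of_bool (y < z) * r y) -
    of_bool (z < x) * r x * (of_bool (y < z) * (r y * gE y))"
  have F: "?F x y = r x * r y * (gE x - gE y) * of_bool (y < z \<and> z < x)" for x y
    by (auto simp: algebra_simps)
  have F0: "?F x y \<ge> 0" for x y
    using g_mono[of y x] r_nonneg[of x] r_nonneg[of y]
    unfolding F by (cases "x \<in> E"; cases "y \<in> E") (auto simp: gE_def r_def)
  have inner: "(LBINT y. ?F x y) = of_bool (z < x) * r x * gE x * M - of_bool (z < x) * r x * G z"
    and innerI: "integrable lborel (?F x)" for x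
    using int unfolding M_def GE by simp_all
  have "(\<integral>\<^sup>+y. ennreal (r x * r y * (gE x - gE y)) * of_bool (y < z \<and> z < x) \<partial>lborel) =
      ennreal (of_bool (z < x) * r x * gE x * M - of_bool (z < x) * r x * G z)" for x
  proof -
    have "(\<integral>\<^sup>+y. ennreal (r x * r y * (gE x - gE y)) * of_bool (y < z \<and> z < x) \<partial>lborel) =
        (\<integral>\<^sup>+y. ennreal (?F x y) \<partial>lborel)"
      unfolding F by (rule nn_integral_cong) auto
    also have "\<dots> = ennreal (LBINT y. ?F x y)"
      by (intro nn_integral_eq_integral innerI AE_I2 F0)
    finally show ?thesis unfolding inner .
  qed
  moreover have "(\<integral>\<^sup>+x. ennreal (of_bool (z < x) * r x * gE x * M - of_bool (z < x) * r x * G z) \<partial>lborel) =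
      ennreal (LBINT x. of_bool (z < x) * r x * gE x * M - of_bool (z < x) * r x * G z)"
  proof (rule nn_integral_eq_integral)
    show "integrable lborel (\<lambda>x. of_bool (z < x) * r x * gE x * M - of_bool (z < x) * r x * G z)"
      using Bochner_Integration.integrable_diff[OF integrable_mult_left[OF int(4), of M] integrable_mult_left[OF int(3), of "G z"]]
      by (simp only: mult.assoc)
    show "AE x in lborel. 0 \<le> of_bool (z < x) * r x * gE x * M - of_bool (z < x) * r x * G z"
      unfolding inner[symmetric] using F0 by (intro AE_I2 Bochner_Integration.integral_nonneg) auto
  qed
  moreover have "(LBINT x. of_bool (z < x) * r x * gE x * M - of_bool (z < x) * r x * G z) = - G z"
  proof -
    have "(LBINT x. of_bool (z < x) * r x) = 1 - M"
      using integral_split_at[OF r_integrable, of z] r_integral by (simp add: M_def)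
    moreover have "(LBINT x. of_bool (z < x) * (r x * gE x)) = - G z"
      using integral_split_at[OF rgE, of z] rg_integral by (simp add: GE r_gE)
    moreover have "(LBINT x. of_bool (z < x) * r x * gE x * M - of_bool (z < x) * r x * G z) =
        (LBINT x. (of_bool (z < x) * (r x * gE x)) * M - (of_bool (z < x) * r x) * G z)"
      by (simp only: mult.assoc)
    moreover have "\<dots> = (LBINT x. of_bool (z < x) * (r x * gE x)) * M - (LBINT x. of_bool (z < x) * r x) * G z"
      using int(3,4) by (simp only: Bochner_Integration.integral_diff integrable_mult_left integral_mult_left_zero)
    ultimately show ?thesis
      by (simp only:) (simp add: algebra_simps)
  qed
  ultimately show ?thesis by simp
qed

text \<open>Common to the inequality, with k = h^2 / g', and to the equality case, with k = g'.
  Values in \<open>ennreal\<close> allow the three integrals to be exchanged without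
  integrability.\<close>

lemma tonelli_identity:
  fixes k :: "real \<Rightarrow> ennreal"
  assumes [measurable]: "k \<in> borel_measurable borel" and k0: "\<And>z. z \<notin> E \<Longrightarrow> k z = 0"
  shows "(\<integral>\<^sup>+x. \<integral>\<^sup>+y. of_bool (y < x) * ennreal (r x * r y * (gE x - gE y)) *
      (\<integral>\<^sup>+z. indicator {y<..<x} z * k z \<partial>lborel) \<partial>lborel \<partial>lborel) = (\<integral>\<^sup>+z. k z * ennreal (- G z) \<partial>lborel)"
proof -
  define W where "W x y = ennreal (r x * r y * (gE x - gE y))" for x y
  have [measurable]: "case_prod W \<in> borel_measurable (borel \<Otimes>\<^sub>M borel)"
    unfolding W_def by measurable
  have "of_bool (y < x) * W x y * (\<integral>\<^sup>+z. indicator {y<..<x} z * k z \<partial>lborel) =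
      (\<integral>\<^sup>+z. k z * (W x y * of_bool (y < z \<and> z < x)) \<partial>lborel)" for x y
  proof -
    have "of_bool (y < x) * W x y * (\<integral>\<^sup>+z. indicator {y<..<x} z * k z \<partial>lborel) =
        (\<integral>\<^sup>+z. of_bool (y < x) * W x y * (indicator {y<..<x} z * k z) \<partial>lborel)"
      by (rule nn_integral_cmult[symmetric]) measurable
    also have "\<dots> = (\<integral>\<^sup>+z. k z * (W x y * of_bool (y < z \<and> z < x)) \<partial>lborel)"
      by (rule nn_integral_cong) (auto simp: indicator_def mult.commute)
    finally show ?thesis .
  qed
  then have "(\<integral>\<^sup>+x. \<integral>\<^sup>+y. of_bool (y < x) * W x y * (\<integral>\<^sup>+z. indicator {y<..<x} z * k z \<partial>lborel) \<partial>lborel \<partial>lborel) =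
      (\<integral>\<^sup>+x. \<integral>\<^sup>+y. \<integral>\<^sup>+z. k z * (W x y * of_bool (y < z \<and> z < x)) \<partial>lborel \<partial>lborel \<partial>lborel)"
    by simp
  also have "\<dots> = (\<integral>\<^sup>+x. \<integral>\<^sup>+z. \<integral>\<^sup>+y. k z * (W x y * of_bool (y < z \<and> z < x)) \<partial>lborel \<partial>lborel \<partial>lborel)"
    by (intro nn_integral_cong lborel_pair.Fubini') measurable
  also have "\<dots> = (\<integral>\<^sup>+z. \<integral>\<^sup>+x. \<integral>\<^sup>+y. k z * (W x y * of_bool (y < z \<and> z < x)) \<partial>lborel \<partial>lborel \<partial>lborel)"
    by (intro lborel_pair.Fubini') measurable
  also have "\<dots> = (\<integral>\<^sup>+z. k z * (\<integral>\<^sup>+x. \<integral>\<^sup>+y. W x y * of_bool (y < z \<and> z < x) \<partial>lborel \<partial>lborel) \<partial>lborel)"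
    by (intro nn_integral_cong) (simp add: nn_integral_cmult)
  also have "\<dots> = (\<integral>\<^sup>+z. k z * ennreal (- G z) \<partial>lborel)"
  proof (rule nn_integral_cong)
    fix z
    show "k z * (\<integral>\<^sup>+x. \<integral>\<^sup>+y. W x y * of_bool (y < z \<and> z < x) \<partial>lborel \<partial>lborel) = k z * ennreal (- G z)"
      using inner_integral[of z] k0[of z] unfolding W_def by (cases "z \<in> E") auto
  qed
  finally show ?thesis unfolding W_def .
qed

text \<open>Over the whole plane the expanded square integrates to twice the second moment: the
  mixed term vanishes because \<open>u\<close> is centered, and the total mass is 1. The integrand
  is symmetric and zero on the diagonal, so the half y < x contributes one half.\<close>

lemma variance_double_integral:
  fixes u :: "real \<Rightarrow> real"
  assumes [measurable]: "u \<in> borel_measurable borel"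
    and u: "integrable lborel (\<lambda>x. r x * u x)" "(LBINT x. r x * u x) = 0" "integrable lborel (\<lambda>x. r x * (u x)\<^sup>2)"
  shows "(\<integral>\<^sup>+x. \<integral>\<^sup>+y. of_bool (y < x) * ennreal (r x * r y * (u x - u y)\<^sup>2) \<partial>lborel \<partial>lborel) =
    ennreal (LBINT x. r x * (u x)\<^sup>2)"
proof -
  define c where "c = (LBINT x. r x * (u x)\<^sup>2)"
  define D where "D x y = ennreal (r x * r y * (u x - u y)\<^sup>2)" for x y
  have [measurable]: "case_prod D \<in> borel_measurable (borel \<Otimes>\<^sub>M borel)"
    unfolding D_def by measurable
  have c0: "c \<ge> 0"
    unfolding c_def by (rule Bochner_Integration.integral_nonneg) (simp add: r_nonneg)
  have exp: "r x * r y * (u x - u y)\<^sup>2 = r x * (u x)\<^sup>2 * r y - 2 * r x * u x * (r y * u y) + r x * (r y * (u y)\<^sup>2)" for x y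
    by (simp add: power2_eq_square algebra_simps)
  have "(\<integral>\<^sup>+y. D x y \<partial>lborel) = ennreal (r x * (u x)\<^sup>2 + r x * c)" for x
  proof -
    have "(\<integral>\<^sup>+y. D x y \<partial>lborel) = ennreal (LBINT y. r x * r y * (u x - u y)\<^sup>2)"
      unfolding D_def
    proof (rule nn_integral_eq_integral)
      show "integrable lborel (\<lambda>y. r x * r y * (u x - u y)\<^sup>2)"
        unfolding exp using u r_integrable by simp
    qed (simp add: r_nonneg)
    also have "(LBINT y. r x * r y * (u x - u y)\<^sup>2) = r x * (u x)\<^sup>2 + r x * c"
      unfolding exp using u r_integrable r_integral by (simp add: c_def)
    finally show ?thesis .
  qed
  then have "(\<integral>\<^sup>+x. \<integral>\<^sup>+y. D x y \<partial>lborel \<partial>lborel) = (\<integral>\<^sup>+x. ennreal (r x * (u x)\<^sup>2 + r x * c) \<partial>lborel)"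
    by simp
  also have "\<dots> = ennreal (LBINT x. r x * (u x)\<^sup>2 + r x * c)"
    using u r_integrable by (intro nn_integral_eq_integral) (auto simp: r_nonneg c0)
  also have "(LBINT x. r x * (u x)\<^sup>2 + r x * c) = 2 * c"
    using u r_integrable r_integral by (simp add: c_def)
  finally have total: "(\<integral>\<^sup>+x. \<integral>\<^sup>+y. D x y \<partial>lborel \<partial>lborel) = ennreal (2 * c)" .
  define V where "V = (\<integral>\<^sup>+x. \<integral>\<^sup>+y. of_bool (y < x) * D x y \<partial>lborel \<partial>lborel)"
  have "D x y = of_bool (y < x) * D x y + of_bool (x < y) * D x y" for x y
    by (cases x y rule: linorder_cases) (auto simp: D_def)
  then have "(\<integral>\<^sup>+x. \<integral>\<^sup>+y. D x y \<partial>lborel \<partial>lborel) =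
      (\<integral>\<^sup>+x. \<integral>\<^sup>+y. of_bool (y < x) * D x y + of_bool (x < y) * D x y \<partial>lborel \<partial>lborel)"
    by simp
  also have "\<dots> = V + (\<integral>\<^sup>+x. \<integral>\<^sup>+y. of_bool (x < y) * D x y \<partial>lborel \<partial>lborel)"
    unfolding V_def by (simp add: nn_integral_add)
  also have "(\<integral>\<^sup>+x. \<integral>\<^sup>+y. of_bool (x < y) * D x y \<partial>lborel \<partial>lborel) =
      (\<integral>\<^sup>+y. \<integral>\<^sup>+x. of_bool (x < y) * D x y \<partial>lborel \<partial>lborel)"
    by (intro lborel_pair.Fubini') measurable
  also have "\<dots> = V"
  proof -
    have "D x y = D y x" for x y
      by (simp add: D_def power2_commute[of "u x"] mult.commute[of "r x"])
    then show ?thesis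
      unfolding V_def by (intro nn_integral_cong) metis
  qed
  finally have "V + V = ennreal (2 * c)" using total by simp
  \<comment> \<open>Halving in \<open>ennreal\<close> requires V to be finite; an infinite V would
    contradict the finite sum.\<close>
  then have "V = ennreal c"
  proof (cases V)
    case (real v)
    with \<open>V + V = ennreal (2 * c)\<close> have "ennreal (v + v) = ennreal (2 * c)"
      using real by (simp only: ennreal_plus)
    then show ?thesis using real c0 by (simp add: ennreal_inj)
  qed simp
  then show ?thesis unfolding V_def D_def c_def .
qed

lemma g_increment:
  assumes xy: "x \<in> E" "y \<in> E" "y < x"
  shows "set_integrable lborel {y<..<x} g'" and "(LBINT z:{y<..<x}. g' z) = g x - g y"
    and "(\<integral>\<^sup>+z. indicator {y<..<x} z * ennreal (indicator E z * g' z) \<partial>lborel) = ennreal (g x - g y)"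
proof -
  have sub: "{y..x} \<subseteq> E" using xy einterval_Icc_subset by blast
  then have subE: "z \<in> E" if "y < z" "z < x" for z using that by auto
  have "integrable lborel (\<lambda>z. indicator {y..x} z *\<^sub>R g' z)"
    using continuous_on_subset[OF g'_cont] sub E_subset_I by (intro borel_integrable_compact) auto
  then have "set_integrable lborel {y..x} g'" by (simp add: set_integrable_def)
  then show si: "set_integrable lborel {y<..<x} g'"
    by (rule set_integrable_subset) auto
  have "(LBINT z. g' z * indicator {y..x} z) = g x - g y"
  proof (rule integral_FTC_Icc_real)
    fix z assume "y \<le> z" "z \<le> x"
    then have z: "z \<in> E" using sub by auto
    then show "(g has_real_derivative g' z) (at z)" by (rule g_deriv_at)
    show "isCont g' z"
      using continuous_on_subset[OF g'_cont E_subset_I] z by (simp add: continuous_on_eq_continuous_at)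
  qed (use xy in simp)
  then have "(LBINT z:{y..x}. g' z) = g x - g y"
    by (simp add: set_lebesgue_integral_def mult.commute)
  then show eq: "(LBINT z:{y<..<x}. g' z) = g x - g y"
    using LBINT_Ioo_eq_Icc[of y x g'] xy by simp
  have "(\<integral>\<^sup>+z. indicator {y<..<x} z * ennreal (indicator E z * g' z) \<partial>lborel) =
      (\<integral>\<^sup>+z. ennreal (indicator {y<..<x} z *\<^sub>R g' z) \<partial>lborel)"
    by (rule nn_integral_cong) (auto simp: indicator_def subE)
  also have "\<dots> = ennreal (g x - g y)"
    using si g'_pos[OF subE] unfolding eq[symmetric] set_integrable_def set_lebesgue_integral_def
    by (intro nn_integral_eq_integral AE_I2) (auto simp: indicator_def less_imp_le)
  finally show "(\<integral>\<^sup>+z. indicator {y<..<x} z * ennreal (indicator E z * g' z) \<partial>lborel) = ennreal (g x - g y)" .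
qed

section \<open>The inequality and its equality case\<close>

lemma has_weak_deriv_measurable:
  assumes "has_weak_deriv a b f h"
  shows "(\<lambda>x. indicator E x * h x) \<in> borel_measurable borel"
  using assms locally_integrable_borel_measurable[OF ab] by (simp add: has_weak_deriv_def)

lemma weighted_energy_measurable:
  assumes w: "\<And>x. x \<in> E \<Longrightarrow> w x = wt x" and h: "(\<lambda>x. indicator E x * h x) \<in> borel_measurable borel"
  shows "(\<lambda>x. sqrt (w x) * h x) \<in> borel_measurable \<mu>" and "(\<lambda>x. w x * (h x)\<^sup>2) \<in> borel_measurable \<mu>"
proof -
  note [measurable] = h
  have "(\<lambda>x. sqrt (indicator E x * wt x) * (indicator E x * h x)) \<in> borel_measurable borel"
    by measurable
  also have "(\<lambda>x. sqrt (indicator E x * wt x) * (indicator E x * h x)) = (\<lambda>x. indicator E x * (sqrt (w x) * h x))"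
    using w by (auto simp: indicator_def fun_eq_iff)
  finally show "(\<lambda>x. sqrt (w x) * h x) \<in> borel_measurable \<mu>"
    unfolding mu_measurable_iff .
  have "(\<lambda>x. (indicator E x * wt x) * (indicator E x * h x)\<^sup>2) \<in> borel_measurable borel"
    by measurable
  also have "(\<lambda>x. (indicator E x * wt x) * (indicator E x * h x)\<^sup>2) = (\<lambda>x. indicator E x * (w x * (h x)\<^sup>2))"
    using w by (auto simp: indicator_def fun_eq_iff)
  finally show "(\<lambda>x. w x * (h x)\<^sup>2) \<in> borel_measurable \<mu>"
    unfolding mu_measurable_iff .
qed

text \<open>On \<open>E\<close> the weight is positive and the root can be squared away; elsewhere
  \<open>r\<close> is 0.\<close>

lemma r_weighted_square:
  assumes w: "\<And>x. x \<in> E \<Longrightarrow> w x = wt x"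
  shows "r x * (sqrt (w x) * c)\<^sup>2 = r x * (w x * c\<^sup>2)"
  using w[of x] wt_pos[of x] by (cases "x \<in> E") (auto simp: r_def power_mult_distrib)

text \<open>\<open>w\<close> is prescribed on the open interval only, so that \<open>wg\<close> can
  be inserted whatever its values at the endpoints.\<close>

lemma weighted_poincare_inequality:
  assumes w: "\<And>x. x \<in> E \<Longrightarrow> w x = wt x" and f: "f \<in> H1 a b \<mu> w" and cf: "centered \<mu> f"
  shows "(\<integral>x. (f x)\<^sup>2 \<partial>\<mu>) \<le> (\<integral>x. w x * (weak_deriv a b f x)\<^sup>2 \<partial>\<mu>)"
proof -
  define h where "h = weak_deriv a b f"
  have W: "has_weak_deriv a b f h"
    using f has_weak_deriv_weak_deriv unfolding h_def H1_def by blast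
  note hE = has_weak_deriv_measurable[OF W]
  have fm: "f \<in> borel_measurable \<mu>" and f2m: "(\<lambda>x. (f x)\<^sup>2) \<in> borel_measurable \<mu>"
    and f2: "integrable \<mu> (\<lambda>x. (f x)\<^sup>2)"
    and wh: "integrable \<mu> (\<lambda>x. (sqrt (w x) * h x)\<^sup>2)"
    using f by (auto simp: H1_def L2_def h_def)
  note whm = weighted_energy_measurable[OF w hE]
  define fE where "fE x = indicator E x * f x" for x
  have fE: "r x * fE x = r x * f x" "r x * (fE x)\<^sup>2 = r x * (f x)\<^sup>2" for x
    by (auto simp: fE_def r_def indicator_def)
  have [measurable]: "fE \<in> borel_measurable borel"
    using fm unfolding mu_measurable_iff fE_def[abs_def] .
  have "integrable lborel (\<lambda>x. r x * (sqrt (w x) * h x)\<^sup>2)"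
    using wh mu_integrable_iff[of "\<lambda>x. (sqrt (w x) * h x)\<^sup>2"] whm(1) by simp
  then have energy: "integrable lborel (\<lambda>x. r x * (w x * (h x)\<^sup>2))"
    by (simp only: r_weighted_square[OF w])
  have energy_nonneg: "r x * (w x * (h x)\<^sup>2) \<ge> 0" for x
    using r_nonneg by (subst r_weighted_square[OF w, symmetric]) auto
  define k where "k z = ennreal (indicator E z * ((h z)\<^sup>2 / g' z))" for z
  have "(\<lambda>z. ennreal ((indicator E z * h z)\<^sup>2 / (indicator E z * g' z))) \<in> borel_measurable borel"
    using hE by measurable
  also have "(\<lambda>z. ennreal ((indicator E z * h z)\<^sup>2 / (indicator E z * g' z))) = k"
    by (auto simp: k_def indicator_def fun_eq_iff)
  finally have k [measurable]: "k \<in> borel_measurable borel" .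
  obtain N where N: "N \<in> null_sets lborel"
    "\<And>x y. x \<in> E - N \<Longrightarrow> y \<in> E - N \<Longrightarrow> x \<le> y \<Longrightarrow> f y - f x = (LBINT t:{x..y}. h t)"
    using weak_deriv_increment[OF ab W] by blast
  \<comment> \<open>The pointwise Cauchy--Schwarz bound, weighted by \<open>r x * r y\<close>.
    Outside \<open>N\<close> the increment of \<open>f\<close> is the integral of \<open>h\<close>;
    pairs with x <= y or not inside \<open>E\<close> make both sides 0.\<close>
  have cs: "of_bool (y < x) * ennreal (r x * r y * (fE x - fE y)\<^sup>2) \<le>
      of_bool (y < x) * ennreal (r x * r y * (gE x - gE y)) * (\<integral>\<^sup>+z. indicator {y<..<x} z * k z \<partial>lborel)"
    if xy: "x \<notin> N" "y \<notin> N" for x y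
  proof (cases "y < x \<and> x \<in> E \<and> y \<in> E")
    case True
    then have y: "y < x" "x \<in> E" "y \<in> E" by auto
    have sub: "{y..x} \<subseteq> E" using y einterval_Icc_subset by blast
    then have subE: "z \<in> E" if "y < z" "z < x" for z using that by auto
    have "set_integrable lborel {y..x} h"
      using W sub compact_Icc unfolding has_weak_deriv_def locally_integrable_def by blast
    then have hi: "set_integrable lborel {y<..<x} h"
      by (rule set_integrable_subset) auto
    have fx: "fE x - fE y = (LBINT z:{y<..<x}. h z)"
      using N(2)[of y x] y xy LBINT_Ioo_eq_Icc[of y x h] by (simp add: fE_def)
    have gx: "gE x - gE y = (LBINT z:{y<..<x}. g' z)" "gE x - gE y > 0"
      using g_increment(2)[of x y] g_strict_mono[of y x] y by (auto simp: gE_def)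
    have "ennreal ((fE x - fE y)\<^sup>2) \<le>
        ennreal (gE x - gE y) * (\<integral>\<^sup>+z. indicator {y<..<x} z * ennreal ((h z)\<^sup>2 / g' z) \<partial>lborel)"
      unfolding fx gx(1)
    proof (rule cauchy_schwarz_Ioo[OF hi g_increment(1)])
      show "g' z > 0" if "y < z" "z < x" for z
        using that sub by (intro g'_pos) auto
      show "(LBINT z:{y<..<x}. g' z) > 0" using gx by simp
    qed (use y in auto)
    also have "(\<integral>\<^sup>+z. indicator {y<..<x} z * ennreal ((h z)\<^sup>2 / g' z) \<partial>lborel) =
        (\<integral>\<^sup>+z. indicator {y<..<x} z * k z \<partial>lborel)"
      by (rule nn_integral_cong) (auto simp: k_def indicator_def subE)
    finally have "ennreal (r x * r y) * ennreal ((fE x - fE y)\<^sup>2) \<le>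
        ennreal (r x * r y) * (ennreal (gE x - gE y) * (\<integral>\<^sup>+z. indicator {y<..<x} z * k z \<partial>lborel))"
      by (rule mult_left_mono) simp
    then show ?thesis
      using y gx(2) r_nonneg[of x] r_nonneg[of y] by (simp add: ennreal_mult' mult.assoc)
  next
    case False
    then show ?thesis by (auto simp: r_def)
  qed
  have "AE x in lborel. x \<notin> N"
    using N(1) by (rule AE_not_in)
  then have "(\<integral>\<^sup>+x. \<integral>\<^sup>+y. of_bool (y < x) * ennreal (r x * r y * (fE x - fE y)\<^sup>2) \<partial>lborel \<partial>lborel) \<le>
      (\<integral>\<^sup>+x. \<integral>\<^sup>+y. of_bool (y < x) * ennreal (r x * r y * (gE x - gE y)) *
        (\<integral>\<^sup>+z. indicator {y<..<x} z * k z \<partial>lborel) \<partial>lborel \<partial>lborel)"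
  proof (intro nn_integral_mono_AE, eventually_elim)
    fix x assume x: "x \<notin> N"
    show "(\<integral>\<^sup>+y. of_bool (y < x) * ennreal (r x * r y * (fE x - fE y)\<^sup>2) \<partial>lborel) \<le>
      (\<integral>\<^sup>+y. of_bool (y < x) * ennreal (r x * r y * (gE x - gE y)) *
        (\<integral>\<^sup>+z. indicator {y<..<x} z * k z \<partial>lborel) \<partial>lborel)"
      using \<open>AE x in lborel. x \<notin> N\<close> by (intro nn_integral_mono_AE, eventually_elim) (rule cs[OF x])
  qed
  also have "\<dots> = (\<integral>\<^sup>+z. k z * ennreal (- G z) \<partial>lborel)"
    using k by (rule tonelli_identity) (simp add: k_def)
  also have "\<dots> = (\<integral>\<^sup>+z. ennreal (r z * (w z * (h z)\<^sup>2)) \<partial>lborel)"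
  proof (rule nn_integral_cong)
    fix z
    show "k z * ennreal (- G z) = ennreal (r z * (w z * (h z)\<^sup>2))"
    proof (cases "z \<in> E")
      case True
      then have "k z * ennreal (- G z) = ennreal ((h z)\<^sup>2 / g' z * (wt z * g' z * r z))"
        using G_neg[of z] g'_pos[of z] ennreal_mult[of "(h z)\<^sup>2 / g' z" "- G z"]
          by (simp add: k_def wt_eq)
      also have "(h z)\<^sup>2 / g' z * (wt z * g' z * r z) = r z * (w z * (h z)\<^sup>2)"
        using g'_pos[OF True] w[OF True] by simp
      finally show ?thesis .
    qed (simp add: k_def r_def)
  qed
  also have "\<dots> = ennreal (LBINT x. r x * (w x * (h x)\<^sup>2))"
    by (intro nn_integral_eq_integral energy AE_I2 energy_nonneg)
  also have "(\<integral>\<^sup>+x. \<integral>\<^sup>+y. of_bool (y < x) * ennreal (r x * r y * (fE x - fE y)\<^sup>2) \<partial>lborel \<partial>lborel) =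
      ennreal (LBINT x. r x * (fE x)\<^sup>2)"
  proof (rule variance_double_integral)
    show "integrable lborel (\<lambda>x. r x * fE x)" "(LBINT x. r x * fE x) = 0"
      using cf mu_integral[OF fm] by (auto simp: fE centered_def)
    show "integrable lborel (\<lambda>x. r x * (fE x)\<^sup>2)"
      using f2 mu_integral[OF f2m] by (simp add: fE)
  qed measurable
  finally have "(LBINT x. r x * (f x)\<^sup>2) \<le> (LBINT x. r x * (w x * (h x)\<^sup>2))"
    using Bochner_Integration.integral_nonneg[of lborel "\<lambda>x. r x * (w x * (h x)\<^sup>2)"] energy_nonneg
    by (simp add: fE ennreal_le_iff)
  then show ?thesis
    using mu_integral_eq[OF f2m] mu_integral_eq[OF whm(2)] by (simp add: h_def)
qed

text \<open>The increment of \<open>g\<close> is the integral of \<open>g'\<close>, so the Tonelli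
  computation holds with equality. Its left-hand side is finite, hence the energy is too, and this
  yields membership in \<open>H1\<close>. The sign \<open>s\<close> serves to return from the
  normalized function to the original one.\<close>

lemma scaled_g_saturates:
  assumes w: "\<And>x. x \<in> E \<Longrightarrow> w x = wt x" and s: "s * s = 1"
    and sg2: "(\<lambda>x. s * g x) \<in> L2 \<mu>"
  shows "(\<lambda>x. s * g x) \<in> H1 a b \<mu> w"
    and "(\<integral>x. (s * g x)\<^sup>2 \<partial>\<mu>) = (\<integral>x. w x * (weak_deriv a b (\<lambda>x. s * g x) x)\<^sup>2 \<partial>\<mu>)"
proof -
  define h where "h = weak_deriv a b (\<lambda>x. s * g x)"
  have Wg: "has_weak_deriv a b (\<lambda>x. s * g x) (\<lambda>x. s * g' x)"
    using continuous_on_subset[OF g'_cont E_subset_I]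
    by (intro C1_has_weak_deriv ab DERIV_cmult g_deriv_at continuous_on_mult_left)
  then have W: "has_weak_deriv a b (\<lambda>x. s * g x) h"
    unfolding h_def by (rule has_weak_deriv_weak_deriv)
  have sq: "(s * c)\<^sup>2 = c\<^sup>2" for c
    using s by (simp add: power_mult_distrib power2_eq_square)
  note hE = has_weak_deriv_measurable[OF W]
  note whm = weighted_energy_measurable[OF w hE]
  have g2i: "integrable \<mu> (\<lambda>x. (g x)\<^sup>2)"
    using sg2 by (simp add: L2_def sq)
  note g2m = borel_measurable_integrable[OF g2i]
  have rg2: "r x * (gE x)\<^sup>2 = r x * (g x)\<^sup>2" for x
    by (auto simp: gE_def r_def indicator_def)
  have int: "integrable lborel (\<lambda>x. r x * (gE x)\<^sup>2)"
    using g2i mu_integral[OF g2m] by (simp add: rg2)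
  define k where "k z = ennreal (indicator E z * g' z)" for z
  have [measurable]: "k \<in> borel_measurable borel"
    unfolding k_def[abs_def] by measurable
  have "ennreal (LBINT x. r x * (gE x)\<^sup>2) =
      (\<integral>\<^sup>+x. \<integral>\<^sup>+y. of_bool (y < x) * ennreal (r x * r y * (gE x - gE y)\<^sup>2) \<partial>lborel \<partial>lborel)"
    using rg_integrable rg_integral int
    by (intro variance_double_integral[symmetric]) (auto simp: r_gE)
  also have "\<dots> = (\<integral>\<^sup>+x. \<integral>\<^sup>+y. of_bool (y < x) * ennreal (r x * r y * (gE x - gE y)) *
        (\<integral>\<^sup>+z. indicator {y<..<x} z * k z \<partial>lborel) \<partial>lborel \<partial>lborel)"
  proof (intro nn_integral_cong)
    fix x y
    show "of_bool (y < x) * ennreal (r x * r y * (gE x - gE y)\<^sup>2) =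
        of_bool (y < x) * ennreal (r x * r y * (gE x - gE y)) * (\<integral>\<^sup>+z. indicator {y<..<x} z * k z \<partial>lborel)"
    proof (cases "y < x \<and> x \<in> E \<and> y \<in> E")
      case True
      then show ?thesis
        using g_increment(3)[of x y] g_strict_mono[of y x]
        by (simp add: k_def gE_def power2_eq_square mult.assoc ennreal_mult''[symmetric])
    next
      case False
      then show ?thesis by (auto simp: r_def)
    qed
  qed
  also have "\<dots> = (\<integral>\<^sup>+z. k z * ennreal (- G z) \<partial>lborel)"
    by (rule tonelli_identity) (auto simp: k_def)
  also have "\<dots> = (\<integral>\<^sup>+z. ennreal (r z * (w z * (h z)\<^sup>2)) \<partial>lborel)"
  proof (rule nn_integral_cong_AE)
    \<comment> \<open>\<open>h\<close> is a chosen representative and agrees with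
      \<open>s * g'\<close> only almost everywhere; its square is that of \<open>g'\<close> because
      s^2 = 1.\<close>
    show "AE z in lborel. k z * ennreal (- G z) = ennreal (r z * (w z * (h z)\<^sup>2))"
      using weak_deriv_unique[OF ab W Wg]
    proof eventually_elim
      case (elim z)
      show ?case
      proof (cases "z \<in> E")
        case True
        then have "k z * ennreal (- G z) = ennreal (g' z * (wt z * g' z * r z))"
          using G_neg[of z] g'_pos[of z] by (simp add: k_def wt_eq flip: ennreal_mult)
        also have "g' z * (wt z * g' z * r z) = r z * (w z * (h z)\<^sup>2)"
          using elim True w[OF True] by (simp add: sq) (simp add: power2_eq_square)
        finally show ?thesis .
      qed (simp add: k_def r_def)
    qed
  qed
  finally have nn: "(\<integral>\<^sup>+z. ennreal (r z * (w z * (h z)\<^sup>2)) \<partial>lborel) = ennreal (LBINT x. r x * (gE x)\<^sup>2)"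
    by simp
  have energy_nonneg: "r x * (w x * (h x)\<^sup>2) \<ge> 0" for x
    using r_nonneg by (subst r_weighted_square[OF w, symmetric]) auto
  have "(\<lambda>x. indicator E x * (w x * (h x)\<^sup>2)) \<in> borel_measurable borel"
    using whm(2) unfolding mu_measurable_iff .
  then have "(\<lambda>x. r x * (indicator E x * (w x * (h x)\<^sup>2))) \<in> borel_measurable borel"
    by measurable
  also have "(\<lambda>x. r x * (indicator E x * (w x * (h x)\<^sup>2))) = (\<lambda>x. r x * (w x * (h x)\<^sup>2))"
    by (auto simp: r_def indicator_def)
  finally have m: "(\<lambda>x. r x * (w x * (h x)\<^sup>2)) \<in> borel_measurable borel" .
  then have energy: "integrable lborel (\<lambda>x. r x * (w x * (h x)\<^sup>2))"
    using energy_nonneg nn by (intro integrableI_nonneg) auto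
  then have "integrable lborel (\<lambda>x. r x * (sqrt (w x) * h x)\<^sup>2)"
    by (simp only: r_weighted_square[OF w])
  then have "integrable \<mu> (\<lambda>x. (sqrt (w x) * h x)\<^sup>2)"
    using mu_integrable_iff[of "\<lambda>x. (sqrt (w x) * h x)\<^sup>2"] whm(1) by simp
  then show "(\<lambda>x. s * g x) \<in> H1 a b \<mu> w"
    using sg2 Wg whm(1) by (auto simp: H1_def L2_def h_def)
  have "(LBINT x. r x * (w x * (h x)\<^sup>2)) = (LBINT x. r x * (gE x)\<^sup>2)"
    using m energy_nonneg nn Bochner_Integration.integral_nonneg[of lborel "\<lambda>x. r x * (gE x)\<^sup>2"] r_nonneg
    by (subst integral_eq_nn_integral) auto
  then show "(\<integral>x. (s * g x)\<^sup>2 \<partial>\<mu>) = (\<integral>x. w x * (weak_deriv a b (\<lambda>x. s * g x) x)\<^sup>2 \<partial>\<mu>)"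
    using mu_integral_eq[OF g2m] mu_integral_eq[OF whm(2)] by (simp add: rg2 h_def sq)
qed

text \<open>A strictly increasing function is nonzero on at least one side of any point. Positivity
  makes \<open>g\<close> non-null and lets the second moment be cancelled when the constant is shown
  to be minimal.\<close>

lemma g_square_integral_pos:
  assumes g2: "g \<in> L2 \<mu>"
  shows "(\<integral>x. (g x)\<^sup>2 \<partial>\<mu>) > 0"
proof -
  have g2m: "(\<lambda>x. (g x)\<^sup>2) \<in> borel_measurable \<mu>" and g2i: "integrable \<mu> (\<lambda>x. (g x)\<^sup>2)"
    using g2 by (auto simp: L2_def)
  obtain c where c: "c \<in> E" using einterval_nonempty[OF ab] by blast
  then obtain e where e: "e > 0" "c - e \<in> E" "c + e \<in> E"
    by (rule einterval_nbhd)
  have nbhd: "x \<in> E" if "c - e < x" "x < c + e" for x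
    using einterval_Icc_subset[OF e(2,3)] that by auto
  obtain p q where pq: "p < q" "\<And>x. p < x \<Longrightarrow> x < q \<Longrightarrow> x \<in> E \<and> g x \<noteq> 0"
  proof (cases "g c \<ge> 0")
    case True
    show ?thesis
    proof (rule that[of c "c + e"])
      show "x \<in> E \<and> g x \<noteq> 0" if "c < x" "x < c + e" for x
        using that nbhd[of x] g_strict_mono[of c x] c True e by auto
    qed (use e in simp)
  next
    case False
    show ?thesis
    proof (rule that[of "c - e" c])
      show "x \<in> E \<and> g x \<noteq> 0" if "c - e < x" "x < c" for x
        using that nbhd[of x] g_strict_mono[of x c] c False e by auto
    qed (use e in simp)
  qed
  have "(LBINT x. r x * (g x)\<^sup>2) > 0"
  proof (rule integral_pos_of_pos_on_interval[OF _ _ pq(1)])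
    show "integrable lborel (\<lambda>x. r x * (g x)\<^sup>2)"
      using g2i mu_integrable_iff[OF g2m] by simp
    show "0 < r x * (g x)\<^sup>2" if "p < x" "x < q" for x
      using pq(2)[OF that] r_pos[of x] by simp
  qed (simp add: r_nonneg)
  then show ?thesis using mu_integral_eq[OF g2m] by simp
qed

end

section \<open>Regularity and boundary values of the weight\<close>

lemma has_real_derivative_transform:
  assumes "x \<in> S" "\<And>x. x \<in> S \<Longrightarrow> g x = f x" "(f has_real_derivative d) (at x within S)"
  shows "(g has_real_derivative d) (at x within S)"
  by (rule has_field_derivative_transform_within[OF assms(3) zero_less_one assms(1)]) (simp add: assms(2))

lemma C1_on_mult:
  assumes "C1_on J f" "C1_on J g"
  shows "C1_on J (\<lambda>x. f x * g x)"
proof -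
  obtain f' g' where D: "\<And>x. x \<in> J \<Longrightarrow> (f has_real_derivative f' x) (at x within J)"
      "\<And>x. x \<in> J \<Longrightarrow> (g has_real_derivative g' x) (at x within J)"
    and c: "continuous_on J f'" "continuous_on J g'"
    using assms unfolding C1_on_def by blast
  have "continuous_on J f" "continuous_on J g"
    by (rule DERIV_continuous_on[OF D(1)] DERIV_continuous_on[OF D(2)]; assumption)+
  then show ?thesis
    unfolding C1_on_def using c
    by (intro exI[of _ "\<lambda>x. f' x * g x + g' x * f x"]) (auto intro!: DERIV_mult D continuous_intros)
qed

lemma C1_on_inverse:
  assumes f: "C1_on J f" and nz: "\<And>x. x \<in> J \<Longrightarrow> f x \<noteq> 0"
  shows "C1_on J (\<lambda>x. 1 / f x)"
proof -
  obtain f' where D: "\<And>x. x \<in> J \<Longrightarrow> (f has_real_derivative f' x) (at x within J)"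
    and c: "continuous_on J f'"
    using f unfolding C1_on_def by blast
  have "continuous_on J f"
    by (rule DERIV_continuous_on[OF D])
  moreover have "((\<lambda>x. 1 / f x) has_real_derivative - (f' x / (f x * f x))) (at x within J)" if "x \<in> J" for x
    using DERIV_inverse_fun[OF D[OF that] nz[OF that]] nz[OF that]
    by (simp add: divide_inverse power2_eq_square mult.commute mult.left_commute)
  ultimately show ?thesis
    unfolding C1_on_def using c nz
    by (intro exI[of _ "\<lambda>x. - (f' x / (f x * f x))"]) (auto intro!: continuous_intros)
qed

lemma C1_on_cong: "C1_on J f \<Longrightarrow> (\<And>x. x \<in> J \<Longrightarrow> f x = g x) \<Longrightarrow> C1_on J g"
  unfolding C1_on_def by (metis has_real_derivative_transform)

section \<open>Filters and one-sided derivatives at the endpoints\<close>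

lemma cinterval_Icc_subset:
  assumes "x \<in> cinterval a b" "y \<in> cinterval a b"
  shows "{x..y} \<subseteq> cinterval a b"
proof
  fix t assume "t \<in> {x..y}"
  then have "ereal x \<le> ereal t" "ereal t \<le> ereal y" by auto
  with assms show "t \<in> cinterval a b"
    by (auto simp: cinterval_def simp del: ereal_less_eq intro: order_trans)
qed

lemma endpoint_cases:
  assumes "e \<in> cinterval a b - einterval a b"
  obtains "a = ereal e" | "b = ereal e"
  using assms by (auto simp: cinterval_def einterval_def le_less)

lemma at_within_Icc_left:
  assumes "a = ereal e" "y \<in> cinterval a b" "e < y"
  shows "at e within {e..y} = at e within cinterval a b"
proof (rule at_within_nhd[of _ "{..<y}"])
  have "e \<in> cinterval a b"
    using assms order_trans[of "ereal e" "ereal y" b] by (auto simp: cinterval_def)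
  then show "{e..y} \<inter> {..<y} - {e} = cinterval a b \<inter> {..<y} - {e}"
    using assms cinterval_Icc_subset[of e a b y] by (auto simp: cinterval_def)
qed (use assms in auto)

lemma at_within_Icc_right:
  assumes "b = ereal e" "y \<in> cinterval a b" "y < e"
  shows "at e within {y..e} = at e within cinterval a b"
proof (rule at_within_nhd[of _ "{y<..}"])
  have "e \<in> cinterval a b"
    using assms order_trans[of a "ereal y" "ereal e"] by (auto simp: cinterval_def)
  then show "{y..e} \<inter> {y<..} - {e} = cinterval a b \<inter> {y<..} - {e}"
    using assms cinterval_Icc_subset[of y a b e] by (auto simp: cinterval_def)
qed (use assms in auto)

text \<open>One compact interval with the same filter at \<open>x\<close> treats interior points and
  endpoints alike: the fundamental theorem of calculus on \<open>{c..d}\<close> then gives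
  derivatives relative to \<open>[a,b]\<close>.\<close>

lemma cinterval_nbhd:
  assumes ab: "a < b" and x: "x \<in> cinterval a b"
  obtains c d where "c < d" "x \<in> {c..d}" "{c..d} \<subseteq> cinterval a b"
    "at x within {c..d} = at x within cinterval a b"
proof -
  obtain y where y: "y \<in> einterval a b" using einterval_nonempty[OF ab] by blast
  then have yc: "y \<in> cinterval a b" using einterval_subset_cinterval by blast
  consider "x \<in> einterval a b" | "a = ereal x" | "b = ereal x"
    using x endpoint_cases by blast
  then show thesis
  proof cases
    case 1
    then obtain e where e: "e > 0" "x - e \<in> einterval a b" "x + e \<in> einterval a b"
      by (rule einterval_nbhd)
    then have sub: "{x - e..x + e} \<subseteq> cinterval a b"
      using einterval_Icc_subset einterval_subset_cinterval by blast
    moreover have "at x within cinterval a b = at x"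
      using 1 einterval_subset_cinterval open_einterval by (meson at_within_interior interiorI)
    moreover have "at x within {x - e..x + e} = at x"
      using e(1) by (intro at_within_interior) auto
    ultimately show thesis
      using e(1) by (intro that[of "x - e" "x + e"]) auto
  next
    case 2
    then have "x < y" using y by (auto simp: einterval_iff)
    then show thesis
      using at_within_Icc_left[OF 2 yc] cinterval_Icc_subset[OF x yc] by (intro that[of x y]) auto
  next
    case 3
    then have "y < x" using y by (auto simp: einterval_iff)
    then show thesis
      using at_within_Icc_right[OF 3 yc] cinterval_Icc_subset[OF yc x] by (intro that[of y x]) auto
  qed
qed

lemma at_within_cinterval_not_bot:
  assumes "a < b" "x \<in> cinterval a b"
  shows "at x within cinterval a b \<noteq> bot"
proof -
  obtain c d where cd: "c < d" "x \<in> {c..d}" "at x within {c..d} = at x within cinterval a b"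
    using cinterval_nbhd[OF assms] by blast
  have "x islimpt {c..d}"
  proof (rule connected_imp_perfect)
    show "{c..d} \<noteq> {z}" for z using cd(1) by (metis atLeastAtMost_singleton_iff less_irrefl)
  qed (use cd in auto)
  then show ?thesis
    unfolding cd(3)[symmetric] by (simp add: trivial_limit_within)
qed

lemma deriv_on_eqI:
  assumes "a < b" "x \<in> cinterval a b" "(f has_real_derivative d) (at x within cinterval a b)"
  shows "deriv_on a b f x = d"
  unfolding deriv_on_def using at_within_cinterval_not_bot[OF assms(1,2)] assms(3)
  by (intro vector_derivative_within) (simp_all add: has_real_derivative_iff_has_vector_derivative)

text \<open>The limits defining \<open>wg\<close> run along \<open>(a,b)\<close>, while continuity
  and derivatives are taken along \<open>[a,b]\<close>. The two sets differ near \<open>e\<close>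
  only in \<open>e\<close> itself.\<close>

lemma at_endpoint_within_einterval:
  assumes "e \<in> cinterval a b - einterval a b"
  shows "at e within einterval a b = at e within cinterval a b"
proof (rule at_within_nhd)
  let ?X = "cinterval a b - einterval a b - {e}"
  have "?X \<subseteq> {real_of_ereal a, real_of_ereal b}"
    by (auto simp: einterval_iff cinterval_def)
  then have "finite ?X" by (rule finite_subset) auto
  then show "open (- ?X)" by (intro open_Compl finite_imp_closed)
  show "e \<in> - ?X" by auto
  show "einterval a b \<inter> - ?X - {e} = cinterval a b \<inter> - ?X - {e}"
    using einterval_subset_cinterval[of a b] assms by auto
qed

text \<open>There are finitely many break points, so some nontrivial interval ending at
  \<open>e\<close> has none in its interior, and \<open>C1_on\<close> includes the one-sided
  derivative at its ends.\<close>

lemma piecewise_C1_on_endpoint_derivative: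
  assumes ab: "a < b" and f: "piecewise_C1_on (cinterval a b) f" and e: "e \<in> cinterval a b - einterval a b"
  obtains d where "(f has_real_derivative d) (at e within cinterval a b)"
proof -
  obtain T where T: "finite T"
    "\<And>J. is_interval J \<Longrightarrow> J \<subseteq> cinterval a b \<Longrightarrow> interior J \<inter> T = {} \<Longrightarrow> C1_on J f"
    using f unfolding piecewise_C1_on_def by blast
  have e': "e \<in> cinterval a b" using e by blast
  obtain y where y: "y \<in> einterval a b" using einterval_nonempty[OF ab] by blast
  have yc: "y \<in> cinterval a b" using y einterval_subset_cinterval by blast
  from e show thesis
  proof (rule endpoint_cases)
    assume a: "a = ereal e"
    then have ey: "e < y" using y by (auto simp: einterval_iff)
    \<comment> \<open>The first break point after \<open>e\<close>, or \<open>y\<close> if there is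
      none up to \<open>y\<close>. The half-open interval excludes \<open>e\<close>, which may be a
      break point itself.\<close>
    define z where "z = Min (insert y (T \<inter> {e<..y}))"
    have fin: "finite (insert y (T \<inter> {e<..y}))" using T(1) by simp
    have "z \<in> insert y (T \<inter> {e<..y})" unfolding z_def using fin by (intro Min_in) auto
    then have z: "e < z" "z \<le> y" using ey by auto
    have zc: "z \<in> cinterval a b" using z cinterval_Icc_subset[OF e' yc] by auto
    have "t \<notin> {e<..<z}" if "t \<in> T" for t
      using Min_le[OF fin, of t] that z by (auto simp: z_def[symmetric])
    then have "C1_on {e..z} f"
      using cinterval_Icc_subset[OF e' zc] by (intro T(2)) (auto simp: is_interval_cc)
    then obtain d where "(f has_real_derivative d) (at e within {e..z})"
      using z unfolding C1_on_def by (metis atLeastAtMost_iff less_imp_le order_refl)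
    then show thesis
      using that at_within_Icc_left[OF a zc z(1)] by auto
  next
    assume b: "b = ereal e"
    then have ey: "y < e" using y by (auto simp: einterval_iff)
    define z where "z = Max (insert y (T \<inter> {y..<e}))"
    have fin: "finite (insert y (T \<inter> {y..<e}))" using T(1) by simp
    have "z \<in> insert y (T \<inter> {y..<e})" unfolding z_def using fin by (intro Max_in) auto
    then have z: "z < e" "y \<le> z" using ey by auto
    have zc: "z \<in> cinterval a b" using z cinterval_Icc_subset[OF yc e'] by auto
    have "t \<notin> {z<..<e}" if "t \<in> T" for t
      using Max_ge[OF fin, of t] that z by (auto simp: z_def[symmetric])
    then have "C1_on {z..e} f"
      using cinterval_Icc_subset[OF zc e'] by (intro T(2)) (auto simp: is_interval_cc)
    then obtain d where "(f has_real_derivative d) (at e within {z..e})"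
      using z unfolding C1_on_def by (metis atLeastAtMost_iff less_imp_le order_refl)
    then show thesis
      using that at_within_Icc_right[OF b zc z(1)] by auto
  qed
qed

section \<open>Boundary behaviour of the weight\<close>

context increasing_centered begin

lemma g_cont: "continuous_on I g"
  by (rule DERIV_continuous_on[OF g_deriv])

lemma interval_integral_eq_G:
  assumes "x \<in> I"
  shows "(LBINT y=a..ereal x. g y * \<rho> y) = G x"
proof -
  have "a \<le> ereal x" "ereal x \<le> b" using assms by (auto simp: cinterval_def)
  then have *: "y \<in> einterval a x \<longleftrightarrow> y < x \<and> y \<in> E" for y
    using less_le_trans[of "ereal y" "ereal x" b] by (auto simp: einterval_iff)
  show ?thesis
  proof -
    have "indicator (einterval a x) y *\<^sub>R (g y * \<rho> y) = of_bool (y < x) * (r y * g y)" for y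
      using * by (simp add: r_def indicator_def)
    then show ?thesis
      using \<open>a \<le> ereal x\<close>
      by (simp only: interval_lebesgue_integral_def set_lebesgue_integral_def G_def if_True)
  qed
qed

text \<open>The derivative is taken within \<open>[a,b]\<close>: its one-sided version at an
  endpoint gives the limit of the weight where g' vanishes.\<close>

lemma G_has_derivative:
  assumes x: "x \<in> I"
  shows "(G has_real_derivative g x * \<rho> x) (at x within I)"
proof -
  obtain c d where cd: "c < d" "x \<in> {c..d}" "{c..d} \<subseteq> I" "at x within {c..d} = at x within I"
    using cinterval_nbhd[OF ab x] by blast
  let ?v = "\<lambda>y. g y * \<rho> y"
  have cont: "continuous_on {c..d} ?v"
    by (intro continuous_on_mult continuous_on_subset[OF g_cont cd(3)] continuous_on_subset[OF rho_cont cd(3)])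
  have eq: "G u = G c + integral {c..u} ?v" if u: "u \<in> {c..d}" for u
  proof -
    have sub: "{c..u} \<subseteq> I" using u cd(3) by auto
    have "G u - G c = (LBINT y. of_bool (y < u) * (r y * g y) - of_bool (y < c) * (r y * g y))"
      unfolding G_def
      by (intro Bochner_Integration.integral_diff[symmetric] integrable_of_bool_mult rg_integrable) auto
    also have "\<dots> = (LBINT y:{c..u}. ?v y)"
      unfolding set_lebesgue_integral_def
    proof (rule integral_discrete_difference[where X = "insert u (I - E)"])
      \<comment> \<open>The integrands differ at most at \<open>u\<close>, where strict and closed
        bounds disagree, and at the endpoints of \<open>[a,b]\<close>, where \<open>r\<close> is 0
        but \<open>\<rho>\<close> is not.\<close>
      show "countable (insert u (I - E))"
        using I_minus_E by (auto intro: countable_finite finite_subset)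
      fix y assume "y \<notin> insert u (I - E)"
      then show "of_bool (y < u) * (r y * g y) - of_bool (y < c) * (r y * g y) = indicator {c..u} y *\<^sub>R ?v y"
        using subsetD[OF sub, of y] u by (auto simp: r_def indicator_def)
    qed auto
    also have "\<dots> = integral {c..u} ?v"
    proof (rule set_borel_integral_eq_integral)
      show "set_integrable lborel {c..u} ?v"
        unfolding set_integrable_def
        using u by (intro borel_integrable_compact continuous_on_subset[OF cont]) auto
    qed
    finally show ?thesis by simp
  qed
  have "((\<lambda>u. integral {c..u} ?v) has_real_derivative ?v x) (at x within {c..d})"
    using integral_has_vector_derivative[OF cont cd(2)]
    by (simp add: has_real_derivative_iff_has_vector_derivative)
  then have "((\<lambda>u. G c + integral {c..u} ?v) has_real_derivative ?v x) (at x within {c..d})"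
    by (auto intro!: derivative_eq_intros)
  then have "(G has_real_derivative ?v x) (at x within {c..d})"
    by (rule has_real_derivative_transform[OF cd(2) eq, rotated])
  then show ?thesis unfolding cd(4) .
qed

lemma G_cont: "continuous_on I G"
  by (rule DERIV_continuous_on[OF G_has_derivative])

text \<open>At the left end nothing is integrated; at the right end the whole integral is 0 because
  \<open>g\<close> is centered.\<close>

lemma G_endpoint:
  assumes "e \<in> I - E"
  shows "G e = 0"
  using assms
proof (rule endpoint_cases)
  assume "a = ereal e"
  then have "\<not> y < e" if "y \<in> E" for y using that by (simp add: einterval_iff)
  then have "of_bool (y < e) * (r y * g y) = 0" for y
    using r_eq_0[of y] by (cases "y \<in> E") auto
  then show ?thesis unfolding G_def by (simp only: integral_zero)
next
  assume "b = ereal e"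
  then have "y < e" if "y \<in> E" for y using that by (simp add: einterval_iff)
  then have "of_bool (y < e) * (r y * g y) = r y * g y" for y
    using r_eq_0[of y] by (cases "y \<in> E") auto
  then show ?thesis using rg_integral unfolding G_def by (simp only:)
qed

text \<open>The derivative may vanish at the endpoints, so the criterion requiring positivity only
  inside the interval is used.\<close>

lemma g_strict_mono_on_I:
  assumes "x \<in> I" "y \<in> I" "x < y"
  shows "g x < g y"
proof (rule DERIV_pos_imp_increasing_open[OF assms(3)])
  show "continuous_on {x..y} g"
    using g_cont continuous_on_subset cinterval_Icc_subset[OF assms(1,2)] by blast
  fix z assume "x < z" "z < y"
  then have "z \<in> E"
    using assms(1,2) le_less_trans[of a "ereal x" "ereal z"] less_le_trans[of "ereal z" "ereal y" b]
    by (auto simp: cinterval_def einterval_iff)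
  then show "\<exists>d. (g has_real_derivative d) (at z) \<and> 0 < d"
    using g_deriv_at g'_pos by blast
qed

text \<open>A zero at an endpoint would give the strictly increasing \<open>g\<close> a constant
  sign on \<open>(a,b)\<close>, and centering would then force G >= 0 inside, against
  \<open>G_neg\<close>.\<close>

lemma g_endpoint_nonzero:
  assumes e: "e \<in> I - E"
  shows "g e \<noteq> 0"
proof
  assume g0: "g e = 0"
  obtain z where z: "z \<in> E" using einterval_nonempty[OF ab] by blast
  from e show False
  proof (rule endpoint_cases)
    assume "a = ereal e"
    then have "e < y" if "y \<in> E" for y using that by (simp add: einterval_iff)
    then have "0 \<le> of_bool (y < z) * (r y * g y)" for y
      using g_strict_mono_on_I[of e y] e r_nonneg[of y] E_subset_I g0
      by (cases "y \<in> E") (auto simp: r_eq_0 less_imp_le)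
    then have "G z \<ge> 0" unfolding G_def by (intro Bochner_Integration.integral_nonneg) auto
    then show False using G_neg[OF z] by simp
  next
    assume "b = ereal e"
    then have "y < e" if "y \<in> E" for y using that by (simp add: einterval_iff)
    then have "0 \<le> of_bool (z < y) * (r y * - g y)" for y
      using g_strict_mono_on_I[of y e] e r_nonneg[of y] E_subset_I g0
      by (cases "y \<in> E") (auto simp: r_eq_0 less_imp_le mult_nonneg_nonpos)
    then have "0 \<le> (LBINT y. of_bool (z < y) * (r y * - g y))"
      by (intro Bochner_Integration.integral_nonneg) auto
    then have "(LBINT y. of_bool (z < y) * (r y * g y)) \<le> 0" by simp
    moreover have "G z + (LBINT y. of_bool (z < y) * (r y * g y)) = 0"
      using integral_split_at[OF rg_integrable, of z] rg_integral by (simp add: G_def)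
    ultimately show False using G_neg[OF z] by simp
  qed
qed

lemma wt_tendsto_endpoint:
  assumes e: "e \<in> I - E" and nz: "g' e \<noteq> 0"
  shows "(wt \<longlongrightarrow> 0) (at e within E)"
proof -
  have e': "e \<in> I" using e by blast
  have lim: "(f \<longlongrightarrow> f e) (at e within E)" if "continuous_on I f" for f :: "real \<Rightarrow> real"
    using that e' E_subset_I tendsto_within_subset unfolding continuous_on_def by blast
  have "((\<lambda>x. - (1 / (g' x * \<rho> x)) * G x) \<longlongrightarrow> - (1 / (g' e * \<rho> e)) * G e) (at e within E)"
    using nz rho_pos[OF e'] by (intro tendsto_intros lim g'_cont rho_cont G_cont) auto
  then show ?thesis
    unfolding wt_def[abs_def] using G_endpoint[OF e] by simp
qed

text \<open>L'Hopital by hand: since \<open>G e\<close> and \<open>g' e\<close> are 0, dividing both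
  by x - e turns them into difference quotients with limits g(e) \<rho>(e) and d, and \<rho>(e)
  cancels. A limit of positive values is nonnegative, and \<open>g_endpoint_nonzero\<close> makes it
  positive.\<close>

lemma wt_tendsto_degenerate_endpoint:
  assumes e: "e \<in> I - E" and g'0: "g' e = 0" and d: "(g' has_real_derivative d) (at e within I)" "d \<noteq> 0"
  shows "(wt \<longlongrightarrow> - g e / d) (at e within E)" and "- g e / d > 0"
proof -
  have e': "e \<in> I" using e by blast
  have filt: "at e within E = at e within I" using at_endpoint_within_einterval[OF e] .
  have "((\<lambda>x. - ((G x - G e) / (x - e)) / (((g' x - g' e) / (x - e)) * \<rho> x)) \<longlongrightarrow>
      - (g e * \<rho> e) / (d * \<rho> e)) (at e within E)"
    unfolding filt
  proof (intro tendsto_intros)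
    show "((\<lambda>x. (G x - G e) / (x - e)) \<longlongrightarrow> g e * \<rho> e) (at e within I)"
      using G_has_derivative[OF e'] by (simp add: has_field_derivative_iff)
    show "((\<lambda>x. (g' x - g' e) / (x - e)) \<longlongrightarrow> d) (at e within I)"
      using d(1) by (simp add: has_field_derivative_iff)
    show "(\<rho> \<longlongrightarrow> \<rho> e) (at e within I)"
      using rho_cont e' by (simp add: continuous_on_def)
    show "d * \<rho> e \<noteq> 0" using d(2) rho_pos[OF e'] by simp
  qed
  moreover have "\<forall>\<^sub>F x in at e within E. - ((G x - G e) / (x - e)) / (((g' x - g' e) / (x - e)) * \<rho> x) = wt x"
    unfolding eventually_at_filter
    by (rule always_eventually) (auto simp: G_endpoint[OF e] g'0 wt_def divide_simps)
  moreover have "- (g e * \<rho> e) / (d * \<rho> e) = - g e / d"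
    using rho_pos[OF e'] by simp
  ultimately show lim: "(wt \<longlongrightarrow> - g e / d) (at e within E)"
    by (simp only: tendsto_cong)
  have "\<forall>\<^sub>F x in at e within E. 0 \<le> wt x"
    unfolding eventually_at_filter by (rule always_eventually) (auto intro: less_imp_le wt_pos)
  then have "0 \<le> - g e / d"
    using lim at_within_cinterval_not_bot[OF ab e'] unfolding filt by (intro tendsto_lowerbound)
  then show "- g e / d > 0"
    using g_endpoint_nonzero[OF e] d(2) by (simp add: less_le)
qed

lemma wt_C1_on:
  assumes J: "J \<subseteq> E" and "C1_on J \<rho>" "C1_on J g'"
  shows "C1_on J wt"
proof -
  have JI: "J \<subseteq> I" using J E_subset_I by blast
  have "C1_on J G"
    unfolding C1_on_def
  proof (intro exI conjI ballI)
    show "(G has_real_derivative g x * \<rho> x) (at x within J)" if "x \<in> J" for x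
      using G_has_derivative[of x] that JI has_field_derivative_subset by blast
    show "continuous_on J (\<lambda>x. g x * \<rho> x)"
      by (intro continuous_on_mult continuous_on_subset[OF g_cont JI] continuous_on_subset[OF rho_cont JI])
  qed
  moreover have "C1_on J (\<lambda>x. - 1 :: real)"
    unfolding C1_on_def by (intro exI[of _ "\<lambda>_. 0"]) auto
  moreover have "C1_on J (\<lambda>x. 1 / (g' x * \<rho> x))"
  proof (intro C1_on_inverse C1_on_mult assms)
    fix x assume "x \<in> J"
    then show "g' x * \<rho> x \<noteq> 0"
      using J JI g'_pos[of x] rho_pos[of x] by (metis less_irrefl mult_eq_0_iff subsetD)
  qed
  ultimately have "C1_on J (\<lambda>x. - 1 * (1 / (g' x * \<rho> x)) * G x)"
    by (intro C1_on_mult)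
  then show ?thesis by (simp add: wt_def[abs_def])
qed

text \<open>\<open>v\<close> will be \<open>wg\<close>, described by its values on \<open>E\<close>
  and by being its own limit at the endpoints. Continuity there reduces to the existence of the
  limits of \<open>wt\<close>, obtained separately for nonzero and zero \<open>g' e\<close>.\<close>

lemma extended_weight:
  assumes pw: "piecewise_C1_on I g'"
    and endp: "\<And>e. e \<in> I - E \<Longrightarrow> g' e \<noteq> 0 \<or> deriv_on a b g' e \<noteq> 0"
    and v: "\<And>x. x \<in> E \<Longrightarrow> v x = wt x" "\<And>e. e \<in> I - E \<Longrightarrow> v e = Lim (at e within E) v"
  shows "v \<in> weights a b"
    and "\<And>e. e \<in> I - E \<Longrightarrow> g' e \<noteq> 0 \<Longrightarrow> v e = 0"
    and "\<And>e. e \<in> I - E \<Longrightarrow> g' e = 0 \<Longrightarrow>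
      v e = - g e / deriv_on a b g' e \<and> - g e / deriv_on a b g' e > 0"
proof -
  have ev: "(v \<longlongrightarrow> l) (at e within E) \<longleftrightarrow> (wt \<longlongrightarrow> l) (at e within E)" for e l
    by (rule tendsto_cong) (auto simp: eventually_at_filter v(1))
  have not_bot: "at e within E \<noteq> bot" if "e \<in> I - E" for e
    using that at_within_cinterval_not_bot[OF ab, of e] at_endpoint_within_einterval[OF that] by auto
  have vI: "v e = l" if "e \<in> I - E" "(wt \<longlongrightarrow> l) (at e within E)" for e l
    using v(2)[OF that(1)] tendsto_Lim[OF not_bot[OF that(1)]] that(2) ev by metis
  have z: "v e = 0" "(wt \<longlongrightarrow> 0) (at e within E)" if "e \<in> I - E" "g' e \<noteq> 0" for e
    using vI wt_tendsto_endpoint that by blast+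
  have nz: "v e = - g e / deriv_on a b g' e" "- g e / deriv_on a b g' e > 0"
    "(wt \<longlongrightarrow> - g e / deriv_on a b g' e) (at e within E)" if e: "e \<in> I - E" "g' e = 0" for e
  proof -
    obtain d where d: "(g' has_real_derivative d) (at e within I)"
      using piecewise_C1_on_endpoint_derivative[OF ab pw e(1)] by blast
    then have dd: "deriv_on a b g' e = d"
      using deriv_on_eqI[OF ab] e(1) by blast
    then have "d \<noteq> 0" using endp[OF e(1)] e(2) by simp
    from wt_tendsto_degenerate_endpoint[OF e d this] vI[OF e(1)]
    show "v e = - g e / deriv_on a b g' e" "- g e / deriv_on a b g' e > 0"
      "(wt \<longlongrightarrow> - g e / deriv_on a b g' e) (at e within E)"
      unfolding dd by auto
  qed
  show "\<And>e. e \<in> I - E \<Longrightarrow> g' e \<noteq> 0 \<Longrightarrow> v e = 0"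
    using z by blast
  show "\<And>e. e \<in> I - E \<Longrightarrow> g' e = 0 \<Longrightarrow>
      v e = - g e / deriv_on a b g' e \<and> - g e / deriv_on a b g' e > 0"
    using nz by blast
  have "continuous_on I v"
    unfolding continuous_on_def
  proof
    fix x assume x: "x \<in> I"
    show "(v \<longlongrightarrow> v x) (at x within I)"
    proof (cases "x \<in> E")
      case True
      have "continuous_on E (\<lambda>x. - (1 / (g' x * \<rho> x)) * G x)"
        using g'_cont rho_cont G_cont E_subset_I
      proof (intro continuous_intros continuous_on_subset[OF _ E_subset_I])
        show "\<forall>x\<in>E. g' x * \<rho> x \<noteq> 0"
          using g'_pos rho_pos E_subset_I by (metis less_irrefl mult_eq_0_iff subsetD)
      qed
      then have "(wt \<longlongrightarrow> wt x) (at x within E)"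
        using True unfolding wt_def[abs_def] continuous_on_def by blast
      then have "(v \<longlongrightarrow> v x) (at x within E)"
        using ev v(1)[OF True] by simp
      moreover have "at x within I = at x within E"
        using True E_subset_I open_einterval by (metis at_within_interior at_within_open interiorI)
      ultimately show ?thesis by simp
    next
      case False
      then have e: "x \<in> I - E" using x by blast
      have "(v \<longlongrightarrow> v x) (at x within E)"
        unfolding ev using z[OF e] nz[OF e] by (cases "g' x = 0") auto
      then show ?thesis using at_endpoint_within_einterval[OF e] by simp
    qed
  qed
  moreover have "piecewise_C1_on E v"
  proof -
    have "piecewise_C1_on I \<rho>"
      using density by (simp add: prob_with_density_def C01_pos_def)
    then obtain T1 where T1: "finite T1"
      "\<And>J. is_interval J \<Longrightarrow> J \<subseteq> I \<Longrightarrow> interior J \<inter> T1 = {} \<Longrightarrow> C1_on J \<rho>"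
      unfolding piecewise_C1_on_def by blast
    obtain T2 where T2: "finite T2"
      "\<And>J. is_interval J \<Longrightarrow> J \<subseteq> I \<Longrightarrow> interior J \<inter> T2 = {} \<Longrightarrow> C1_on J g'"
      using pw unfolding piecewise_C1_on_def by blast
    have "C1_on J v" if J: "is_interval J" "J \<subseteq> E" "interior J \<inter> (T1 \<union> T2) = {}" for J
    proof (rule C1_on_cong[OF wt_C1_on])
      have "J \<subseteq> I" using J(2) E_subset_I by blast
      then show "C1_on J \<rho>" "C1_on J g'" using J by (blast intro: T1(2), blast intro: T2(2))
    qed (use J v(1) in auto)
    then show ?thesis
      unfolding piecewise_C1_on_def using T1(1) T2(1) by (intro exI[of _ "T1 \<union> T2"]) auto
  qed
  ultimately show "v \<in> weights a b"
    using v(1) wt_pos by (auto simp: weights_def)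
qed

lemma finite_interval_L2:
  assumes "\<bar>a\<bar> \<noteq> \<infinity>" "\<bar>b\<bar> \<noteq> \<infinity>"
  shows "g \<in> L2 \<mu>"
proof -
  obtain \<alpha> \<beta> where ab': "a = ereal \<alpha>" "b = ereal \<beta>" using assms by auto
  have I: "I = {\<alpha>..\<beta>}" by (auto simp: cinterval_def ab')
  have "bounded (g ` I)"
    using g_cont compact_Icc unfolding I by (intro compact_imp_bounded compact_continuous_image)
  then obtain B where B: "\<bar>g x\<bar> \<le> B" if "x \<in> I" for x
    by (auto simp: bounded_iff)
  have gm: "g \<in> borel_measurable \<mu>" using centered by (auto simp: centered_def)
  then have g2m: "(\<lambda>x. (g x)\<^sup>2) \<in> borel_measurable \<mu>" by measurable
  have "integrable lborel (\<lambda>x. r x * (gE x)\<^sup>2)"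
  proof (rule Bochner_Integration.integrable_bound)
    show "integrable lborel (\<lambda>x. B\<^sup>2 * r x)" using r_integrable by simp
    show "AE x in lborel. norm (r x * (gE x)\<^sup>2) \<le> norm (B\<^sup>2 * r x)"
    proof (rule AE_I2)
      fix x
      show "norm (r x * (gE x)\<^sup>2) \<le> norm (B\<^sup>2 * r x)"
      proof (cases "x \<in> E")
        case True
        then have "\<bar>g x\<bar> \<le> B" using B E_subset_I by blast
        then have "(g x)\<^sup>2 \<le> B\<^sup>2" using abs_le_square_iff[of "g x" B] by linarith
        then have "r x * (g x)\<^sup>2 \<le> r x * B\<^sup>2"
          using r_nonneg by (rule mult_left_mono)
        then show ?thesis
          using r_nonneg[of x] True by (simp add: gE_def abs_mult mult.commute[of "B\<^sup>2"])
      qed (simp add: r_def)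
    qed
  qed measurable
  also have "(\<lambda>x. r x * (gE x)\<^sup>2) = (\<lambda>x. r x * (g x)\<^sup>2)"
    by (auto simp: gE_def r_def indicator_def)
  finally show ?thesis
    using gm g2m mu_integrable_iff[OF g2m] by (simp add: L2_def)
qed

end

section \<open>Reduction to increasing \<open>g\<close> and conclusion\<close>

lemma L2_cmult:
  assumes "u \<in> L2 \<mu>"
  shows "(\<lambda>x. c * u x) \<in> L2 \<mu>"
proof -
  have "u \<in> borel_measurable \<mu>" "integrable \<mu> (\<lambda>x. c\<^sup>2 * (u x)\<^sup>2)"
    using assms by (auto simp: L2_def)
  then show ?thesis
    by (auto simp: L2_def power_mult_distrib)
qed

theorem theorem3p1:
  fixes a b :: ereal and \<mu> :: "real measure" and \<rho> g :: "real \<Rightarrow> real"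
  assumes "a < b"
    and "prob_with_density a b \<mu> \<rho>"
    and "g \<in> C12_star a b"
    and "centered \<mu> g"
    and "\<forall>\<alpha>. a = ereal \<alpha> \<longrightarrow>
           deriv_on a b g \<alpha> \<noteq> 0 \<or>
           (deriv_on a b g \<alpha> = 0 \<and> deriv_on a b (deriv_on a b g) \<alpha> \<noteq> 0)"
    and "\<forall>\<beta>. b = ereal \<beta> \<longrightarrow>
           deriv_on a b g \<beta> \<noteq> 0 \<or>
           (deriv_on a b g \<beta> = 0 \<and> deriv_on a b (deriv_on a b g) \<beta> \<noteq> 0)"
  shows "(wg a b \<rho> g \<in> weights a b \<and>
          (\<forall>\<alpha>. a = ereal \<alpha> \<longrightarrow>
             (deriv_on a b g \<alpha> \<noteq> 0 \<longrightarrow> wg a b \<rho> g \<alpha> = 0) \<and>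
             (deriv_on a b g \<alpha> = 0 \<and> deriv_on a b (deriv_on a b g) \<alpha> \<noteq> 0 \<longrightarrow>
                wg a b \<rho> g \<alpha> = - g \<alpha> / deriv_on a b (deriv_on a b g) \<alpha> \<and>
                - g \<alpha> / deriv_on a b (deriv_on a b g) \<alpha> > 0)) \<and>
          (\<forall>\<beta>. b = ereal \<beta> \<longrightarrow>
             (deriv_on a b g \<beta> \<noteq> 0 \<longrightarrow> wg a b \<rho> g \<beta> = 0) \<and>
             (deriv_on a b g \<beta> = 0 \<and> deriv_on a b (deriv_on a b g) \<beta> \<noteq> 0 \<longrightarrow>
                wg a b \<rho> g \<beta> = - g \<beta> / deriv_on a b (deriv_on a b g) \<beta> \<and>
                - g \<beta> / deriv_on a b (deriv_on a b g) \<beta> > 0)))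
       \<and> (g \<in> L2 \<mu> \<longrightarrow>
            weighted_poincare a b \<mu> (wg a b \<rho> g) 1 \<and>
            poincare_constant a b \<mu> (wg a b \<rho> g) = 1 \<and>
            saturates a b \<mu> (wg a b \<rho> g) g)
       \<and> (\<bar>a\<bar> \<noteq> \<infinity> \<and> \<bar>b\<bar> \<noteq> \<infinity> \<longrightarrow> g \<in> L2 \<mu>)"
proof -
  let ?I = "cinterval a b" and ?E = "einterval a b" and ?w = "wg a b \<rho> g"
  note ab = assms(1)
  obtain s :: real where s: "s = 1 \<or> s = - 1" and C: "(\<lambda>x. s * deriv_on a b g x) \<in> C01_pos a b"
  proof -
    have "(\<lambda>x. 1 * deriv_on a b g x) \<in> C01_pos a b \<or> (\<lambda>x. - 1 * deriv_on a b g x) \<in> C01_pos a b"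
      using assms(3) by (simp add: C12_star_def)
    then show thesis using that[of 1] that[of "- 1"] by argo
  qed
  then have ss: "s * s = 1" "s \<noteq> 0" by auto
  have ssg: "s * (s * c) = c" for c using ss by (simp flip: mult.assoc)
  have D: "(g has_real_derivative deriv_on a b g x) (at x within ?I)" if "x \<in> ?I" for x
    using assms(3) that
    by (auto simp: C12_star_def differentiable_on_def deriv_on_def
        has_real_derivative_iff_has_vector_derivative vector_derivative_works[symmetric])
  interpret M: increasing_centered a b \<mu> \<rho> "\<lambda>x. s * g x" "\<lambda>x. s * deriv_on a b g x"
  proof
    show "a < b" "prob_with_density a b \<mu> \<rho>" by fact+
    show "centered \<mu> (\<lambda>x. s * g x)" using assms(4) by (auto simp: centered_def)
    show "((\<lambda>x. s * g x) has_real_derivative s * deriv_on a b g x) (at x within ?I)" if "x \<in> ?I" for x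
      using D[OF that] by (rule DERIV_cmult)
    show "continuous_on ?I (\<lambda>x. s * deriv_on a b g x)"
      and "\<And>x. x \<in> ?E \<Longrightarrow> 0 < s * deriv_on a b g x"
      using C by (auto simp: C01_pos_def)
  qed
  have pw: "piecewise_C1_on ?I (\<lambda>x. s * deriv_on a b g x)"
    using C by (simp add: C01_pos_def)
  \<comment> \<open>\<open>deriv_on\<close> is a choice, so pulling out \<open>s\<close> needs
    differentiability at the endpoint, which the piecewise C1 property supplies.\<close>
  have d2: "deriv_on a b (\<lambda>x. s * deriv_on a b g x) e = s * deriv_on a b (deriv_on a b g) e"
    if e: "e \<in> ?I - ?E" for e
  proof -
    obtain d where d: "((\<lambda>x. s * deriv_on a b g x) has_real_derivative d) (at e within ?I)"
      using piecewise_C1_on_endpoint_derivative[OF ab pw e] by blast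
    then have "((\<lambda>x. s * (s * deriv_on a b g x)) has_real_derivative s * d) (at e within ?I)"
      by (rule DERIV_cmult)
    then have "(deriv_on a b g has_real_derivative s * d) (at e within ?I)"
      by (simp only: ssg)
    with d show ?thesis
      using deriv_on_eqI[OF ab] e by (simp add: ssg)
  qed
  \<comment> \<open>\<open>s\<close> occurs once in the integral and once in the derivative, so it
    cancels: \<open>s * g\<close> has the same weight as \<open>g\<close>.\<close>
  have inner: "wg_inner a b \<rho> g x = M.wt x" if "x \<in> ?E" for x
  proof -
    have "M.G x = (LBINT y=a..ereal x. s * (g y * \<rho> y))"
      using M.interval_integral_eq_G[of x] that einterval_subset_cinterval[of a b] by (auto simp: mult.assoc)
    also have "\<dots> = s * (LBINT y=a..ereal x. g y * \<rho> y)"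
      by simp
    finally show ?thesis
      using ss by (simp add: wg_inner_def M.wt_def)
  qed
  then have w: "?w x = M.wt x" if "x \<in> ?E" for x
    using that by (simp add: wg_def)
  have wLim: "?w e = Lim (at e within ?E) ?w" if "e \<in> ?I - ?E" for e
  proof -
    have "Lim (at e within ?E) (wg_inner a b \<rho> g) = Lim (at e within ?E) ?w"
      by (rule Lim_cong) (simp_all add: eventually_at_filter inner w)
    then show ?thesis
      using that by (simp add: wg_def[of a b \<rho> g e])
  qed
  have endpoint: "e \<in> ?I - ?E" if "a = ereal e \<or> b = ereal e" for e
    using that ab by (auto simp: cinterval_def einterval_def)
  have endp: "s * deriv_on a b g e \<noteq> 0 \<or> deriv_on a b (\<lambda>x. s * deriv_on a b g x) e \<noteq> 0"
    if e: "e \<in> ?I - ?E" for e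
    unfolding d2[OF e] using endpoint_cases[OF e] assms(5,6) ss(2) by (metis mult_eq_0_iff)
  note W = M.extended_weight[OF pw endp w wLim]
  have boundary: "(deriv_on a b g e \<noteq> 0 \<longrightarrow> ?w e = 0) \<and>
      (deriv_on a b g e = 0 \<and> deriv_on a b (deriv_on a b g) e \<noteq> 0 \<longrightarrow>
        ?w e = - g e / deriv_on a b (deriv_on a b g) e \<and> - g e / deriv_on a b (deriv_on a b g) e > 0)"
    if "a = ereal e \<or> b = ereal e" for e
  proof -
    have e: "e \<in> ?I - ?E" using endpoint that .
    have "- (s * g e) / (s * deriv_on a b (deriv_on a b g) e) = - g e / deriv_on a b (deriv_on a b g) e"
      using ss(2) by simp
    then show ?thesis
      using W(2)[OF _ _ _ e] W(3)[OF _ _ _ e] ss(2) by (simp add: d2[OF e])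
  qed
  have L2: "(\<lambda>x. s * g x) \<in> L2 \<mu> \<longleftrightarrow> g \<in> L2 \<mu>"
    using L2_cmult[of g \<mu> s] L2_cmult[of "\<lambda>x. s * g x" \<mu> s] by (auto simp: ssg)
  have "weighted_poincare a b \<mu> ?w 1 \<and> poincare_constant a b \<mu> ?w = 1 \<and> saturates a b \<mu> ?w g"
    if g2: "g \<in> L2 \<mu>"
  proof -
    have wp: "weighted_poincare a b \<mu> ?w 1"
      using M.weighted_poincare_inequality[OF w] by (simp add: weighted_poincare_def)
    \<comment> \<open>The function of the locale is \<open>s * g\<close>; scaling it once more by
      \<open>s\<close> returns \<open>g\<close>.\<close>
    have H1: "g \<in> H1 a b \<mu> ?w"
      and eq: "(\<integral>x. (g x)\<^sup>2 \<partial>\<mu>) = (\<integral>x. ?w x * (weak_deriv a b g x)\<^sup>2 \<partial>\<mu>)"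
      using M.scaled_g_saturates[OF w ss(1)] g2 by (simp_all only: ssg)
    have pos: "(\<integral>x. (g x)\<^sup>2 \<partial>\<mu>) > 0"
      using M.g_square_integral_pos g2 s by (auto simp: L2)
    have const: "poincare_constant a b \<mu> ?w = 1"
      unfolding poincare_constant_def
    proof (rule Least_equality)
      show "weighted_poincare a b \<mu> ?w 1" by (fact wp)
    next
      fix C assume "weighted_poincare a b \<mu> ?w C"
      \<comment> \<open>Any admissible constant is tested with \<open>g\<close>, whose energy equals
        its second moment.\<close>
      then have "(\<integral>x. (g x)\<^sup>2 \<partial>\<mu>) \<le> C * (\<integral>x. ?w x * (weak_deriv a b g x)\<^sup>2 \<partial>\<mu>)"
        using H1 assms(4) by (simp add: weighted_poincare_def)
      then have "(\<integral>x. (g x)\<^sup>2 \<partial>\<mu>) \<le> C * (\<integral>x. (g x)\<^sup>2 \<partial>\<mu>)"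
        by (simp only: eq[symmetric])
      then show "1 \<le> C" using pos by simp
    qed
    have "\<not> (AE x in \<mu>. g x = 0)"
    proof
      assume "AE x in \<mu>. g x = 0"
      then have "AE x in \<mu>. (g x)\<^sup>2 = 0" by eventually_elim simp
      then have "(\<integral>x. (g x)\<^sup>2 \<partial>\<mu>) = 0" by (rule integral_eq_zero_AE)
      with pos show False by simp
    qed
    then have "saturates a b \<mu> ?w g"
      using H1 eq assms(4) const by (simp add: saturates_def)
    with wp const show ?thesis by blast
  qed
  moreover have "g \<in> L2 \<mu>" if "\<bar>a\<bar> \<noteq> \<infinity>" "\<bar>b\<bar> \<noteq> \<infinity>"
    using M.finite_interval_L2[OF that] L2 by simp
  moreover have "?w \<in> weights a b" by (rule W(1))
  ultimately show ?thesis
    by (intro conjI allI impI) (use boundary in metis)+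
qed

end
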